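(* Let $m\ge1$ and let $C$ be an $m$-truncated free crossed resolution of a group $G$, with $\varphi:C_1\to G$. Let $p:\widetilde C\to C$ be the universal cover of $C$, let $h$ be a partial contracting homotopy of $\widetilde C$, and suppose that $\widetilde C_m$ is free on $\widetilde X_m$. If $m=1$, then $\ker(\varphi:C_1\to G)$ is generated as a normal subgroup of $C_1$ by the elements $$p_1\big((h_0\widetilde\delta^0\tilde x)^{-1}\,\tilde x\,(h_0\widetilde\delta^1\tilde x)\big),\qquad \tilde x\in\widetilde X_1.$$ If $m\ge2$, then $\ker(\delta_m:C_m\to C_{m-1})$ is generated as a $G$-module by the elements $$p_2\big((h_1\widetilde\delta_2\tilde x)^{-1}\,\tilde x^{h_0\beta\tilde x}\big),\quad \tilde x\in\widetilde X_2,\qquad\text{if } m=2,$$ $$p_m\big(-h_{m-1}\widetilde\delta_m\tilde x+\tilde x^{h_0\beta\tilde x}\big),\quad \tilde x\in\widetilde X_m,\qquad\text{if } m\ge3.$$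
   Context: In a groupoid the composite of $a:x\to y$, $b:y\to z$ is $ab:x\to z$. A crossed module over a groupoid $\Phi$ is a family of groups $M=(M(x))_{x\in Ob\,\Phi}$ with a groupoid morphism $\mu:M\to\Phi$, identity on objects, and a right action of $\Phi$ on $M$ ($m^u\in M(y)$ for $m\in M(x)$, $u\in\Phi(x,y)$) with $\mu(m^u)=u^{-1}\mu(m)u$ and $n^{-1}mn=m^{\mu n}$. The free crossed $\Phi$-module on a family of functions $w:S(x)\to\Phi(x,x)$ is the universal crossed $\Phi$-module $\mu:M\to\Phi$ with maps $S(x)\to M(x)$ lifting $w$. A crossed complex $C$ consists of a set $C_0$, a groupoid $C_1$ on $C_0$ (source $\delta^0$, target $\delta^1$), families of groups $C_n=(C_n(x))_{x\in C_0}$ for $n\ge2$ with base point map $\beta$ ($\beta c=x$ for $c\in C_n(x)$), right actions of $C_1$ on $C_n$ for $n\ge2$, and morphisms $\delta_n:C_n\to C_{n-1}$ ($n\ge2$) over the identity on $C_0$, such that: $\delta_2$ is a crossed module over $C_1$; for $n\ge3$, $C_n$ is a $C_1$-module (abelian, written additively) and $\delta_n$ preserves the action; $\delta_{n-1}\delta_n$ is trivial for $n\ge3$; $\delta_2C_2$ acts trivially on $C_n$ for $n\ge3$. Dimensions 1 and 2 are written multiplicatively. An $m$-truncated crossed complex has this structure only in dimensions $\le m$. An $m$-truncated free crossed resolution of a group $G$ is an $m$-truncated crossed complex $C$ with $C_0$ a single point, together with an epimorphism $\varphi:C_1\to G$, such that $C_1$ is a free group; if $m\ge2$, $C_2$ is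 a free crossed $C_1$-module and $\delta_2(C_2)=\ker\varphi$ (so $C_n$ is a $G$-module for $n\ge3$, as is $\ker\delta_2$); $C_n$ is a free $G$-module for $3\le n\le m$; and $\ker\delta_n=\operatorname{im}\delta_{n+1}$ for $2\le n<m$. The universal cover $p:\widetilde C\to C$: $\widetilde C_0=G$; $\widetilde C_1$ is the groupoid on $G$ with arrows $(g,u)\in G\times C_1$, source $g$, target $g(\varphi u)$, composition $(g,u)(g(\varphi u),v)=(g,uv)$; for $n\ge2$, $\widetilde C_n(g)=\{g\}\times C_n$ (group structure from $C_n$), $(g,c)^{(g,u)}=(g(\varphi u),c^u)$, $\widetilde\delta_n(g,c)=(g,\delta_nc)$; and $p_n(g,c)=c$. Let $\widetilde G$ be the groupoid on $G$ with arrows $(g,g'):g\to gg'$. That $\widetilde C_m$ is free on $\widetilde X_m$ means: $m=1$: $\widetilde C_1$ is the free groupoid on the subgraph $\widetilde X_1$ (with all objects $G$); $m=2$: $\widetilde C_2$ is the free crossed $\widetilde C_1$-module on $\widetilde X_2$; $m\ge3$: $\widetilde C_m$ is the free $\widetilde G$-module on $\widetilde X_m$. A partial contracting homotopy $h$ of the $m$-truncated crossed complex $\widetilde C$ (to the base point $1\in G$) is a family of functions $h_n$ on $\widetilde C_n$, $0\le n<m$, satisfying those of the following conditions that make sense: $h_0(g)$ is an arrow $g\to1$ of $\widetilde C_1$ for each $g\in G$; $h_n(\widetilde C_n)\subseteq\widetilde C_{n+1}(1)$ for $n\ge1$; $h_1:\widetilde C_1\to\widetilde C_2(1)$ is a groupoid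 morphism; for $n\ge2$, $h_n:\widetilde C_n\to\widetilde C_{n+1}(1)$ is a morphism (a group homomorphism on each $\widetilde C_n(g)$) with $h_n(c^{a})=h_n(c)$ whenever $a\in\widetilde C_1$ and $c^a$ is defined; and $\widetilde\delta_2h_1c=(h_0\widetilde\delta^0c)^{-1}c\,(h_0\widetilde\delta^1c)$ for $c\in\widetilde C_1$; $\widetilde\delta_3h_2c=(h_1\widetilde\delta_2c)^{-1}c^{h_0\beta c}$ for $c\in\widetilde C_2$; $\widetilde\delta_{n+1}h_nc=-h_{n-1}\widetilde\delta_nc+c^{h_0\beta c}$ for $c\in\widetilde C_n$, $n\ge3$. *)

theory Defs
  imports "HOL-Algebra.Coset" "HOL-Library.Disjoint_Sets"
begin

section \<open>Groupoids\<close>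

text \<open>Composition is written in diagrammatic order: \<open>gcmp \<Phi> a b\<close> is \<open>ab : x \<rightarrow> z\<close> for \<open>a : x \<rightarrow> y\<close>,
  \<open>b : y \<rightarrow> z\<close>. Its value on non-composable pairs is irrelevant.\<close>

record ('o, 'a) groupoid =
  gobj :: "'o set"
  garr :: "'a set"
  gsrc :: "'a \<Rightarrow> 'o"
  gtgt :: "'a \<Rightarrow> 'o"
  gid :: "'o \<Rightarrow> 'a"
  gcmp :: "'a \<Rightarrow> 'a \<Rightarrow> 'a"

locale groupoid =
  fixes \<Phi> :: "('o, 'a) groupoid"
  assumes src_closed: "a \<in> garr \<Phi> \<Longrightarrow> gsrc \<Phi> a \<in> gobj \<Phi>"
    and tgt_closed: "a \<in> garr \<Phi> \<Longrightarrow> gtgt \<Phi> a \<in> gobj \<Phi>"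
    and id_arr: "x \<in> gobj \<Phi> \<Longrightarrow> gid \<Phi> x \<in> garr \<Phi>"
    and id_src: "x \<in> gobj \<Phi> \<Longrightarrow> gsrc \<Phi> (gid \<Phi> x) = x"
    and id_tgt: "x \<in> gobj \<Phi> \<Longrightarrow> gtgt \<Phi> (gid \<Phi> x) = x"
    and cmp_arr: "\<lbrakk>a \<in> garr \<Phi>; b \<in> garr \<Phi>; gtgt \<Phi> a = gsrc \<Phi> b\<rbrakk> \<Longrightarrow> gcmp \<Phi> a b \<in> garr \<Phi>"
    and cmp_src: "\<lbrakk>a \<in> garr \<Phi>; b \<in> garr \<Phi>; gtgt \<Phi> a = gsrc \<Phi> b\<rbrakk>
      \<Longrightarrow> gsrc \<Phi> (gcmp \<Phi> a b) = gsrc \<Phi> a"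
    and cmp_tgt: "\<lbrakk>a \<in> garr \<Phi>; b \<in> garr \<Phi>; gtgt \<Phi> a = gsrc \<Phi> b\<rbrakk>
      \<Longrightarrow> gtgt \<Phi> (gcmp \<Phi> a b) = gtgt \<Phi> b"
    and cmp_assoc: "\<lbrakk>a \<in> garr \<Phi>; b \<in> garr \<Phi>; c \<in> garr \<Phi>;
        gtgt \<Phi> a = gsrc \<Phi> b; gtgt \<Phi> b = gsrc \<Phi> c\<rbrakk>
      \<Longrightarrow> gcmp \<Phi> (gcmp \<Phi> a b) c = gcmp \<Phi> a (gcmp \<Phi> b c)"
    and id_left: "a \<in> garr \<Phi> \<Longrightarrow> gcmp \<Phi> (gid \<Phi> (gsrc \<Phi> a)) a = a"
    and id_right: "a \<in> garr \<Phi> \<Longrightarrow> gcmp \<Phi> a (gid \<Phi> (gtgt \<Phi> a)) = a"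
    and inverse_ex: "a \<in> garr \<Phi> \<Longrightarrow> \<exists>b \<in> garr \<Phi>. gsrc \<Phi> b = gtgt \<Phi> a \<and> gtgt \<Phi> b = gsrc \<Phi> a \<and>
      gcmp \<Phi> a b = gid \<Phi> (gsrc \<Phi> a) \<and> gcmp \<Phi> b a = gid \<Phi> (gtgt \<Phi> a)"

definition garrows :: "('o, 'a) groupoid \<Rightarrow> 'o \<Rightarrow> 'o \<Rightarrow> 'a set" where
  "garrows \<Phi> x y = {a \<in> garr \<Phi>. gsrc \<Phi> a = x \<and> gtgt \<Phi> a = y}"

definition ginv :: "('o, 'a) groupoid \<Rightarrow> 'a \<Rightarrow> 'a" where
  "ginv \<Phi> a = (THE b. b \<in> garr \<Phi> \<and> gsrc \<Phi> b = gtgt \<Phi> a \<and> gtgt \<Phi> b = gsrc \<Phi> a \<and>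
      gcmp \<Phi> a b = gid \<Phi> (gsrc \<Phi> a) \<and> gcmp \<Phi> b a = gid \<Phi> (gtgt \<Phi> a))"

definition vertex_group :: "('o, 'a) groupoid \<Rightarrow> 'o \<Rightarrow> 'a monoid" where
  "vertex_group \<Phi> x = \<lparr>carrier = garrows \<Phi> x x, monoid.mult = gcmp \<Phi>, monoid.one = gid \<Phi> x\<rparr>"

definition groupoid_morphism ::
  "('o, 'a) groupoid \<Rightarrow> ('p, 'b) groupoid \<Rightarrow> ('o \<Rightarrow> 'p) \<Rightarrow> ('a \<Rightarrow> 'b) \<Rightarrow> bool" where
  "groupoid_morphism \<Phi> \<Psi> f0 f \<longleftrightarrow>
     f0 ` gobj \<Phi> \<subseteq> gobj \<Psi> \<and>
     (\<forall>a \<in> garr \<Phi>. f a \<in> garrows \<Psi> (f0 (gsrc \<Phi> a)) (f0 (gtgt \<Phi> a))) \<and>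
     (\<forall>x \<in> gobj \<Phi>. f (gid \<Phi> x) = gid \<Psi> (f0 x)) \<and>
     (\<forall>a \<in> garr \<Phi>. \<forall>b \<in> garr \<Phi>. gtgt \<Phi> a = gsrc \<Phi> b \<longrightarrow> f (gcmp \<Phi> a b) = gcmp \<Psi> (f a) (f b))"

text \<open>A group as a groupoid with one object.\<close>

definition group_groupoid :: "'g monoid \<Rightarrow> (unit, 'g) groupoid" where
  "group_groupoid G = \<lparr>gobj = {()}, garr = carrier G, gsrc = (\<lambda>_. ()), gtgt = (\<lambda>_. ()),
     gid = (\<lambda>_. \<one>\<^bsub>G\<^esub>), gcmp = monoid.mult G\<rparr>"

section \<open>Modules and crossed modules over a groupoid\<close>

text \<open>All groups, including the abelian ones that are customarily written additively, are
  multiplicative \<open>monoid\<close> records. A family \<open>M\<close> of groups is given by its members \<open>M x\<close>, with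
  pairwise disjoint carriers, so that every element has a unique base point. \<open>act m u\<close> is \<open>m\<^sup>u\<close>.\<close>

abbreviation elems :: "('o, 'a) groupoid \<Rightarrow> ('o \<Rightarrow> 'm monoid) \<Rightarrow> 'm set" where
  "elems \<Phi> M \<equiv> (\<Union>x \<in> gobj \<Phi>. carrier (M x))"

locale groupoid_action = groupoid \<Phi> for \<Phi> :: "('o, 'a) groupoid" +
  fixes M :: "'o \<Rightarrow> 'm monoid" and act :: "'m \<Rightarrow> 'a \<Rightarrow> 'm"
  assumes groups: "x \<in> gobj \<Phi> \<Longrightarrow> group (M x)"
    and disjoint: "disjoint_family_on (\<lambda>x. carrier (M x)) (gobj \<Phi>)"
    and act_hom: "u \<in> garr \<Phi> \<Longrightarrow> (\<lambda>m. act m u) \<in> hom (M (gsrc \<Phi> u)) (M (gtgt \<Phi> u))"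
    and act_id: "\<lbrakk>x \<in> gobj \<Phi>; m \<in> carrier (M x)\<rbrakk> \<Longrightarrow> act m (gid \<Phi> x) = m"
    and act_cmp: "\<lbrakk>u \<in> garr \<Phi>; v \<in> garr \<Phi>; gtgt \<Phi> u = gsrc \<Phi> v; m \<in> carrier (M (gsrc \<Phi> u))\<rbrakk>
      \<Longrightarrow> act m (gcmp \<Phi> u v) = act (act m u) v"

locale groupoid_module = groupoid_action +
  assumes commutative: "x \<in> gobj \<Phi> \<Longrightarrow> comm_group (M x)"

locale crossed_module = groupoid_action \<Phi> M act
  for \<Phi> :: "('o, 'a) groupoid" and M :: "'o \<Rightarrow> 'm monoid" and act +
  fixes \<mu> :: "'m \<Rightarrow> 'a"
  assumes boundary_hom: "x \<in> gobj \<Phi> \<Longrightarrow> \<mu> \<in> hom (M x) (vertex_group \<Phi> x)"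
    and equivariant: "\<lbrakk>u \<in> garr \<Phi>; m \<in> carrier (M (gsrc \<Phi> u))\<rbrakk>
      \<Longrightarrow> \<mu> (act m u) = gcmp \<Phi> (gcmp \<Phi> (ginv \<Phi> u) (\<mu> m)) u"
    and peiffer: "\<lbrakk>x \<in> gobj \<Phi>; m \<in> carrier (M x); n \<in> carrier (M x)\<rbrakk>
      \<Longrightarrow> inv\<^bsub>M x\<^esub> n \<otimes>\<^bsub>M x\<^esub> m \<otimes>\<^bsub>M x\<^esub> n = act m (\<mu> n)"

text \<open>Morphisms over the identity of \<open>\<Phi>\<close> of families of groups with \<open>\<Phi>\<close>-action.\<close>

definition action_morphism ::
  "('o, 'a) groupoid \<Rightarrow> ('o \<Rightarrow> 'm monoid) \<Rightarrow> ('m \<Rightarrow> 'a \<Rightarrow> 'm) \<Rightarrow>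
   ('o \<Rightarrow> 'n monoid) \<Rightarrow> ('n \<Rightarrow> 'a \<Rightarrow> 'n) \<Rightarrow> ('m \<Rightarrow> 'n) \<Rightarrow> bool" where
  "action_morphism \<Phi> M act N act' f \<longleftrightarrow>
     (\<forall>x \<in> gobj \<Phi>. f \<in> hom (M x) (N x)) \<and>
     (\<forall>u \<in> garr \<Phi>. \<forall>m \<in> carrier (M (gsrc \<Phi> u)). f (act m u) = act' (f m) u)"

section \<open>Free objects\<close>

text \<open>Freeness is the universal property. As a HOL formula cannot quantify over types, the test
  objects range over the structures on one fixed type of lists. It is infinite and at least as
  large as both the structure in question and the free structure on the given generators,
  so isomorphic copies of both of these occur among the test objects, and the property is
  equivalent to the one with test objects of arbitrary type. Uniqueness of an induced map is
  uniqueness on the relevant carrier, expressed by \<open>extensional\<close>.\<close>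

definition free_group_on :: "'a monoid \<Rightarrow> 'a set \<Rightarrow> bool" where
  "free_group_on F S \<longleftrightarrow> group F \<and> S \<subseteq> carrier F \<and>
     (\<forall>(H :: 'a list monoid) f. group H \<longrightarrow> f ` S \<subseteq> carrier H \<longrightarrow>
        (\<exists>!k. k \<in> extensional (carrier F) \<and> k \<in> hom F H \<and> (\<forall>s \<in> S. k s = f s)))"

text \<open>The free groupoid on a subgraph with arrows \<open>Xs\<close> and with all the objects of \<open>\<Phi>\<close>: graph
  morphisms \<open>(f0, f)\<close> on it extend uniquely.\<close>

definition free_groupoid_on :: "('o, 'a) groupoid \<Rightarrow> 'a set \<Rightarrow> bool" where
  "free_groupoid_on \<Phi> Xs \<longleftrightarrow> groupoid \<Phi> \<and> Xs \<subseteq> garr \<Phi> \<and>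
     (\<forall>(\<Psi> :: ('o, 'a list) groupoid) f0 f. groupoid \<Psi> \<longrightarrow> f0 ` gobj \<Phi> \<subseteq> gobj \<Psi> \<longrightarrow>
        (\<forall>a \<in> Xs. f a \<in> garrows \<Psi> (f0 (gsrc \<Phi> a)) (f0 (gtgt \<Phi> a))) \<longrightarrow>
        (\<exists>!k. k \<in> extensional (garr \<Phi>) \<and> groupoid_morphism \<Phi> \<Psi> f0 k \<and> (\<forall>a \<in> Xs. k a = f a)))"

text \<open>\<open>M\<close> is the free crossed \<open>\<Phi>\<close>-module on the family of functions \<open>w : S x \<rightarrow> \<Phi>(x, x)\<close>, by means of
  the maps \<open>\<iota> : S x \<rightarrow> M x\<close> lifting \<open>w\<close>.\<close>

definition free_crossed_module_on ::
  "('o, 'a) groupoid \<Rightarrow> ('o \<Rightarrow> 'm monoid) \<Rightarrow> ('m \<Rightarrow> 'a \<Rightarrow> 'm) \<Rightarrow> ('m \<Rightarrow> 'a) \<Rightarrow>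
   ('o \<Rightarrow> 's set) \<Rightarrow> ('s \<Rightarrow> 'a) \<Rightarrow> ('s \<Rightarrow> 'm) \<Rightarrow> bool" where
  "free_crossed_module_on \<Phi> M act \<mu> S w \<iota> \<longleftrightarrow>
     crossed_module \<Phi> M act \<mu> \<and>
     (\<forall>x \<in> gobj \<Phi>. \<forall>s \<in> S x. w s \<in> garrows \<Phi> x x \<and> \<iota> s \<in> carrier (M x) \<and> \<mu> (\<iota> s) = w s) \<and>
     (\<forall>(N :: 'o \<Rightarrow> ('s + 'a + 'm) list monoid) act' \<nu> f.
        crossed_module \<Phi> N act' \<nu> \<longrightarrow>
        (\<forall>x \<in> gobj \<Phi>. \<forall>s \<in> S x. f s \<in> carrier (N x) \<and> \<nu> (f s) = w s) \<longrightarrow>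
        (\<exists>!k. k \<in> extensional (elems \<Phi> M) \<and> action_morphism \<Phi> M act N act' k \<and>
           (\<forall>m \<in> elems \<Phi> M. \<nu> (k m) = \<mu> m) \<and> (\<forall>x \<in> gobj \<Phi>. \<forall>s \<in> S x. k (\<iota> s) = f s)))"

definition free_groupoid_module_on ::
  "('o, 'a) groupoid \<Rightarrow> ('o \<Rightarrow> 'm monoid) \<Rightarrow> ('m \<Rightarrow> 'a \<Rightarrow> 'm) \<Rightarrow> 'm set \<Rightarrow> bool" where
  "free_groupoid_module_on \<Phi> M act Xs \<longleftrightarrow>
     groupoid_module \<Phi> M act \<and> Xs \<subseteq> elems \<Phi> M \<and>
     (\<forall>(N :: 'o \<Rightarrow> ('a + 'm) list monoid) act' f.
        groupoid_module \<Phi> N act' \<longrightarrow>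
        (\<forall>x \<in> gobj \<Phi>. \<forall>s \<in> Xs \<inter> carrier (M x). f s \<in> carrier (N x)) \<longrightarrow>
        (\<exists>!k. k \<in> extensional (elems \<Phi> M) \<and> action_morphism \<Phi> M act N act' k \<and>
           (\<forall>s \<in> Xs. k s = f s)))"

section \<open>Modules over a group\<close>

abbreviation group_module :: "'g monoid \<Rightarrow> 'm monoid \<Rightarrow> ('m \<Rightarrow> 'g \<Rightarrow> 'm) \<Rightarrow> bool" where
  "group_module G A act \<equiv> groupoid_module (group_groupoid G) (\<lambda>_. A) act"

abbreviation free_group_module_on ::
  "'g monoid \<Rightarrow> 'm monoid \<Rightarrow> ('m \<Rightarrow> 'g \<Rightarrow> 'm) \<Rightarrow> 'm set \<Rightarrow> bool" where
  "free_group_module_on G A act B \<equiv> free_groupoid_module_on (group_groupoid G) (\<lambda>_. A) act B"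

definition generated_as_module ::
  "'g monoid \<Rightarrow> 'm monoid \<Rightarrow> ('m \<Rightarrow> 'g \<Rightarrow> 'm) \<Rightarrow> 'm set \<Rightarrow> bool" where
  "generated_as_module G A act Xs \<longleftrightarrow> group_module G A act \<and> Xs \<subseteq> carrier A \<and>
     (\<forall>H. subgroup H A \<longrightarrow> (\<forall>c \<in> H. \<forall>g \<in> carrier G. act c g \<in> H) \<longrightarrow> Xs \<subseteq> H \<longrightarrow> H = carrier A)"

definition generated_as_normal_subgroup :: "'a monoid \<Rightarrow> 'a set \<Rightarrow> 'a set \<Rightarrow> bool" where
  "generated_as_normal_subgroup F K Xs \<longleftrightarrow> K = \<Inter>{N. N \<lhd> F \<and> Xs \<subseteq> N}"

section \<open>Truncated crossed complexes\<close>

text \<open>All the \<open>C\<^sub>n\<close>, \<open>n \<ge> 1\<close>, have elements in one type \<open>'c\<close>. \<open>cgrpd\<close> is \<open>C\<^sub>1\<close> with object set \<open>C\<^sub>0\<close>;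
  the other components are indexed by the dimension \<open>n \<ge> 2\<close>, and \<open>cbd C n\<close> is
  \<open>\<delta>\<^sub>n : C\<^sub>n \<rightarrow> C\<^sub>n\<^sub>-\<^sub>1\<close>. In an \<open>m\<close>-truncated complex the components of index \<open>n > m\<close> carry
  no information.\<close>

record ('o, 'c) crossed_complex =
  cgrpd :: "('o, 'c) groupoid"
  cfam :: "nat \<Rightarrow> 'o \<Rightarrow> 'c monoid"
  cbase :: "nat \<Rightarrow> 'c \<Rightarrow> 'o"
  cact :: "nat \<Rightarrow> 'c \<Rightarrow> 'c \<Rightarrow> 'c"
  cbd :: "nat \<Rightarrow> 'c \<Rightarrow> 'c"

definition dim_group :: "('o, 'c) crossed_complex \<Rightarrow> nat \<Rightarrow> 'o \<Rightarrow> 'c monoid" where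
  "dim_group C n x = (if n = 1 then vertex_group (cgrpd C) x else cfam C n x)"

definition truncated_crossed_complex :: "nat \<Rightarrow> ('o, 'c) crossed_complex \<Rightarrow> bool" where
  "truncated_crossed_complex m C \<longleftrightarrow>
     groupoid (cgrpd C) \<and>
     (\<forall>n \<in> {2..m}. \<forall>x \<in> gobj (cgrpd C). \<forall>c \<in> carrier (cfam C n x). cbase C n c = x) \<and>
     (2 \<le> m \<longrightarrow> crossed_module (cgrpd C) (cfam C 2) (cact C 2) (cbd C 2)) \<and>
     (\<forall>n \<in> {3..m}.
        groupoid_module (cgrpd C) (cfam C n) (cact C n) \<and>
        action_morphism (cgrpd C) (cfam C n) (cact C n) (cfam C (n-1)) (cact C (n-1)) (cbd C n) \<and>
        (\<forall>x \<in> gobj (cgrpd C). \<forall>c \<in> carrier (cfam C n x).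
           cbd C (n-1) (cbd C n c) = \<one>\<^bsub>dim_group C (n-2) x\<^esub>) \<and>
        (\<forall>x \<in> gobj (cgrpd C). \<forall>c \<in> carrier (cfam C n x). \<forall>d \<in> carrier (cfam C 2 x).
           cact C n c (cbd C 2 d) = c))"

section \<open>Free crossed resolutions of a group\<close>

text \<open>The action of \<open>G\<close> on \<open>C\<^sub>n\<close> (\<open>n \<ge> 3\<close>) and on \<open>ker \<delta>\<^sub>2\<close> induced along \<open>\<phi> : C\<^sub>1 \<rightarrow> G\<close>:
  \<open>c\<^sup>g = c\<^sup>u\<close> for any \<open>u\<close> with \<open>\<phi> u = g\<close>. It does not depend on the choice of \<open>u\<close>, since
  \<open>ker \<phi> = \<delta>\<^sub>2 C\<^sub>2\<close> acts trivially.\<close>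

definition induced_act ::
  "('o, 'c) crossed_complex \<Rightarrow> ('c \<Rightarrow> 'g) \<Rightarrow> nat \<Rightarrow> 'c \<Rightarrow> 'g \<Rightarrow> 'c" where
  "induced_act C \<phi> n c g = cact C n c (inv_into (garr (cgrpd C)) \<phi> g)"

text \<open>The index set of the free generators in dimension 2 may be taken inside the type \<open>'c\<close>, because
  \<open>\<iota>\<close> is injective for a free crossed module.\<close>

definition free_crossed_resolution ::
  "nat \<Rightarrow> 'g monoid \<Rightarrow> 'o \<Rightarrow> ('o, 'c) crossed_complex \<Rightarrow> ('c \<Rightarrow> 'g) \<Rightarrow> bool" where
  "free_crossed_resolution m G pt C \<phi> \<longleftrightarrow>
     group G \<and> truncated_crossed_complex m C \<and> gobj (cgrpd C) = {pt} \<and>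
     \<phi> \<in> epi (vertex_group (cgrpd C) pt) G \<and>
     (\<exists>S. free_group_on (vertex_group (cgrpd C) pt) S) \<and>
     (2 \<le> m \<longrightarrow>
        (\<exists>(S :: 'o \<Rightarrow> 'c set) w \<iota>.
           free_crossed_module_on (cgrpd C) (cfam C 2) (cact C 2) (cbd C 2) S w \<iota>) \<and>
        cbd C 2 ` carrier (cfam C 2 pt) = kernel (vertex_group (cgrpd C) pt) G \<phi>) \<and>
     (\<forall>n \<in> {3..m}. \<exists>B. free_group_module_on G (cfam C n pt) (induced_act C \<phi> n) B) \<and>
     (\<forall>n \<in> {2..<m}. kernel (cfam C n pt) (dim_group C (n-1) pt) (cbd C n) =
        cbd C (n+1) ` carrier (cfam C (n+1) pt))"

section \<open>The universal cover\<close>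

definition universal_cover ::
  "'g monoid \<Rightarrow> 'o \<Rightarrow> ('o, 'c) crossed_complex \<Rightarrow> ('c \<Rightarrow> 'g) \<Rightarrow> ('g, 'g \<times> 'c) crossed_complex" where
  "universal_cover G pt C \<phi> =
     \<lparr>cgrpd = \<lparr>gobj = carrier G, garr = carrier G \<times> garr (cgrpd C),
        gsrc = fst, gtgt = (\<lambda>(g, u). g \<otimes>\<^bsub>G\<^esub> \<phi> u), gid = (\<lambda>g. (g, gid (cgrpd C) pt)),
        gcmp = (\<lambda>(g, u) (_, v). (g, gcmp (cgrpd C) u v))\<rparr>,
      cfam = (\<lambda>n g. \<lparr>carrier = {g} \<times> carrier (cfam C n pt),
        monoid.mult = (\<lambda>(_, c) (_, d). (g, c \<otimes>\<^bsub>cfam C n pt\<^esub> d)), monoid.one = (g, \<one>\<^bsub>cfam C n pt\<^esub>)\<rparr>),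
      cbase = (\<lambda>n. fst),
      cact = (\<lambda>n (g, c) (_, u). (g \<otimes>\<^bsub>G\<^esub> \<phi> u, cact C n c u)),
      cbd = (\<lambda>n (g, c). (g, cbd C n c))\<rparr>"

text \<open>The covering morphism \<open>p\<^sub>n\<close> in dimensions \<open>n \<ge> 1\<close>.\<close>

definition cover_proj :: "nat \<Rightarrow> 'g \<times> 'c \<Rightarrow> 'c" where
  "cover_proj n = snd"

text \<open>The groupoid with object set \<open>G\<close> and arrows \<open>(g, g') : g \<rightarrow> gg'\<close>, and its
  action on the cover in dimensions \<open>n \<ge> 3\<close>.\<close>

definition cover_groupoid :: "'g monoid \<Rightarrow> ('g, 'g \<times> 'g) groupoid" where
  "cover_groupoid G = \<lparr>gobj = carrier G, garr = carrier G \<times> carrier G,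
     gsrc = fst, gtgt = (\<lambda>(g, g'). g \<otimes>\<^bsub>G\<^esub> g'), gid = (\<lambda>g. (g, \<one>\<^bsub>G\<^esub>)),
     gcmp = (\<lambda>(g, a) (_, b). (g, a \<otimes>\<^bsub>G\<^esub> b))\<rparr>"

definition cover_act ::
  "'g monoid \<Rightarrow> ('o, 'c) crossed_complex \<Rightarrow> ('c \<Rightarrow> 'g) \<Rightarrow> nat \<Rightarrow> 'g \<times> 'c \<Rightarrow> 'g \<times> 'g \<Rightarrow> 'g \<times> 'c" where
  "cover_act G C \<phi> n = (\<lambda>(g, c) (_, a). (g \<otimes>\<^bsub>G\<^esub> a, induced_act C \<phi> n c a))"

definition cover_free_on ::
  "nat \<Rightarrow> 'g monoid \<Rightarrow> 'o \<Rightarrow> ('o, 'c) crossed_complex \<Rightarrow> ('c \<Rightarrow> 'g) \<Rightarrow> ('g \<times> 'c) set \<Rightarrow> bool" where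
  "cover_free_on m G pt C \<phi> Xs \<longleftrightarrow>
     (let D = universal_cover G pt C \<phi> in
      if m = 1 then free_groupoid_on (cgrpd D) Xs
      else if m = 2 then
        Xs \<subseteq> elems (cgrpd D) (cfam D 2) \<and>
        free_crossed_module_on (cgrpd D) (cfam D 2) (cact D 2) (cbd D 2)
          (\<lambda>g. Xs \<inter> carrier (cfam D 2 g)) (cbd D 2) id
      else free_groupoid_module_on (cover_groupoid G) (cfam D m) (cover_act G C \<phi> m) Xs)"

section \<open>Partial contracting homotopies\<close>

text \<open>A partial contracting homotopy of the \<open>m\<close>-truncated crossed complex \<open>D\<close> to the base point \<open>e\<close>;
  \<open>h0\<close> is its component on \<open>D\<^sub>0\<close> and \<open>h n\<close>, for \<open>1 \<le> n < m\<close>, its component on \<open>D\<^sub>n\<close>.\<close>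

definition partial_contracting_homotopy ::
  "nat \<Rightarrow> ('o, 'c) crossed_complex \<Rightarrow> 'o \<Rightarrow> ('o \<Rightarrow> 'c) \<Rightarrow> (nat \<Rightarrow> 'c \<Rightarrow> 'c) \<Rightarrow> bool" where
  "partial_contracting_homotopy m D e h0 h \<longleftrightarrow>
     (let P = cgrpd D in
      (\<forall>x \<in> gobj P. h0 x \<in> garrows P x e) \<and>
      (1 < m \<longrightarrow>
         (\<forall>c \<in> garr P. h 1 c \<in> carrier (cfam D 2 e)) \<and>
         (\<forall>c \<in> garr P. \<forall>d \<in> garr P. gtgt P c = gsrc P d \<longrightarrow>
            h 1 (gcmp P c d) = h 1 c \<otimes>\<^bsub>cfam D 2 e\<^esub> h 1 d) \<and>
         (\<forall>c \<in> garr P. cbd D 2 (h 1 c) =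
            gcmp P (gcmp P (ginv P (h0 (gsrc P c))) c) (h0 (gtgt P c)))) \<and>
      (\<forall>n \<in> {2..<m}.
         (\<forall>x \<in> gobj P. h n \<in> hom (cfam D n x) (cfam D (n+1) e)) \<and>
         (\<forall>a \<in> garr P. \<forall>c \<in> carrier (cfam D n (gsrc P a)). h n (cact D n c a) = h n c) \<and>
         (\<forall>x \<in> gobj P. \<forall>c \<in> carrier (cfam D n x).
            cbd D (n+1) (h n c) =
              inv\<^bsub>cfam D n e\<^esub> (h (n-1) (cbd D n c)) \<otimes>\<^bsub>cfam D n e\<^esub> cact D n c (h0 (cbase D n c)))))"

end

theory Submission
  imports Defs
begin

text \<open>For \<open>m \<ge> 2\<close> let \<open>\<theta>\<close> send \<open>c\<close> in \<open>C\<^sub>m(g)\<close>, the cover over \<open>g\<close>, to the inverse of \<open>h(\<delta> c)\<close> times \<open>c\<close>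
  acted on by \<open>h\<^sub>0(g)\<close>. It is a homomorphism from each \<open>C\<^sub>m(g)\<close> into the central subgroup \<open>ker \<delta>\<^sub>m\<close>,
  it is invariant under the action, and over the base point it is the identity on \<open>ker \<delta>\<^sub>m\<close>. Given
  a subgroup \<open>H\<close> of the kernel containing the values of \<open>\<theta>\<close> on the free generators, the elements
  that \<open>\<theta>\<close> maps into \<open>H\<close> form a substructure of the cover containing these generators, hence
  everything, so \<open>H\<close> is the kernel. For \<open>m = 1\<close> the formula gives a groupoid morphism into \<open>ker \<phi>\<close>
  that conjugates \<open>ker \<phi>\<close> over the base point, and \<open>H\<close> is normal. A substructure \<open>T\<close> containing
  free generators is everything because the map into \<open>T\<close> given by the universal property
  composes with the inclusion to the identity.\<close>

section \<open>Substructures containing a free generating set\<close>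

text \<open>If \<open>b\<close> and \<open>c\<close> are both inverse to \<open>a\<close>, then
  \<open>c = c(ab) = (ca)b = b\<close>. This uniqueness makes the definite description in
  \<open>ginv\<close> usable.\<close>

lemma (in groupoid) ginv_equality:
  assumes "a \<in> garr \<Phi>" "b \<in> garr \<Phi>" "gsrc \<Phi> b = gtgt \<Phi> a" "gtgt \<Phi> b = gsrc \<Phi> a"
    and "gcmp \<Phi> a b = gid \<Phi> (gsrc \<Phi> a)" "gcmp \<Phi> b a = gid \<Phi> (gtgt \<Phi> a)"
  shows "ginv \<Phi> a = b"
  unfolding ginv_def
proof (rule the_equality)
  fix c assume c: "c \<in> garr \<Phi> \<and> gsrc \<Phi> c = gtgt \<Phi> a \<and> gtgt \<Phi> c = gsrc \<Phi> a \<and>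
      gcmp \<Phi> a c = gid \<Phi> (gsrc \<Phi> a) \<and> gcmp \<Phi> c a = gid \<Phi> (gtgt \<Phi> a)"
  have "gcmp \<Phi> c (gcmp \<Phi> a b) = gcmp \<Phi> (gcmp \<Phi> c a) b"
    using assms c by (intro cmp_assoc[symmetric]) auto
  then show "c = b"
    using assms(2-5) c id_left[of b] id_right[of c] by metis
qed (use assms in auto)

lemma (in groupoid) ginv_props:
  assumes "a \<in> garr \<Phi>"
  shows "ginv \<Phi> a \<in> garr \<Phi>" "gsrc \<Phi> (ginv \<Phi> a) = gtgt \<Phi> a" "gtgt \<Phi> (ginv \<Phi> a) = gsrc \<Phi> a"
    "gcmp \<Phi> a (ginv \<Phi> a) = gid \<Phi> (gsrc \<Phi> a)" "gcmp \<Phi> (ginv \<Phi> a) a = gid \<Phi> (gtgt \<Phi> a)"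
  using inverse_ex[OF assms] ginv_equality[OF assms] by metis+

text \<open>Singleton lists are used because the test groupoids in \<open>free_groupoid_on\<close>
  have arrows of type \<open>'a list\<close>. All objects are kept, so the object map can be the
  identity.\<close>

definition subgroupoid_copy :: "('o, 'a) groupoid \<Rightarrow> 'a set \<Rightarrow> ('o, 'a list) groupoid" where
  "subgroupoid_copy \<Phi> T = \<lparr>gobj = gobj \<Phi>, garr = (\<lambda>a. [a]) ` T, gsrc = gsrc \<Phi> \<circ> hd,
     gtgt = gtgt \<Phi> \<circ> hd, gid = (\<lambda>x. [gid \<Phi> x]), gcmp = (\<lambda>a b. [gcmp \<Phi> (hd a) (hd b)])\<rparr>"

lemma (in groupoid) subgroupoid_copy_groupoid:
  assumes "T \<subseteq> garr \<Phi>" "\<And>x. x \<in> gobj \<Phi> \<Longrightarrow> gid \<Phi> x \<in> T"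
    and "\<And>a b. \<lbrakk>a \<in> T; b \<in> T; gtgt \<Phi> a = gsrc \<Phi> b\<rbrakk> \<Longrightarrow> gcmp \<Phi> a b \<in> T"
    and "\<And>a. a \<in> T \<Longrightarrow> ginv \<Phi> a \<in> T"
  shows "groupoid (subgroupoid_copy \<Phi> T)"
proof
  fix a assume "a \<in> garr (subgroupoid_copy \<Phi> T)"
  then obtain t where t: "a = [t]" "t \<in> T" "t \<in> garr \<Phi>"
    using assms(1) by (auto simp: subgroupoid_copy_def)
  show "\<exists>b\<in>garr (subgroupoid_copy \<Phi> T).
            gsrc (subgroupoid_copy \<Phi> T) b = gtgt (subgroupoid_copy \<Phi> T) a \<and>
            gtgt (subgroupoid_copy \<Phi> T) b = gsrc (subgroupoid_copy \<Phi> T) a \<and>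
            gcmp (subgroupoid_copy \<Phi> T) a b =
            gid (subgroupoid_copy \<Phi> T) (gsrc (subgroupoid_copy \<Phi> T) a) \<and>
            gcmp (subgroupoid_copy \<Phi> T) b a =
            gid (subgroupoid_copy \<Phi> T) (gtgt (subgroupoid_copy \<Phi> T) a)"
    by (rule bexI[of _ "[ginv \<Phi> t]"])
       (use t ginv_props[OF t(3)] assms(4) in \<open>auto simp: subgroupoid_copy_def\<close>)
qed (use assms in \<open>auto simp: subgroupoid_copy_def subset_iff src_closed tgt_closed id_arr id_src
       id_tgt cmp_arr cmp_src cmp_tgt cmp_assoc id_left id_right\<close>)

text \<open>Existence in the universal property gives a morphism \<open>k\<close> into the copy of
  \<open>T\<close> sending each generator \<open>a\<close> to \<open>[a]\<close>. Viewed as a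
  morphism into the copy of the whole groupoid, \<open>k\<close> must be
  \<open>a \<mapsto> [a]\<close> by uniqueness, so every arrow lies in \<open>T\<close>.\<close>

lemma free_groupoid_on_subgroupoid:
  assumes free: "free_groupoid_on \<Phi> Xs" and T: "T \<subseteq> garr \<Phi>" "Xs \<subseteq> T"
    and ids: "\<And>x. x \<in> gobj \<Phi> \<Longrightarrow> gid \<Phi> x \<in> T"
    and cmps: "\<And>a b. \<lbrakk>a \<in> T; b \<in> T; gtgt \<Phi> a = gsrc \<Phi> b\<rbrakk> \<Longrightarrow> gcmp \<Phi> a b \<in> T"
    and invs: "\<And>a. a \<in> T \<Longrightarrow> ginv \<Phi> a \<in> T"
  shows "T = garr \<Phi>"
proof -
  interpret groupoid \<Phi> using free by (simp add: free_groupoid_on_def)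
  define j :: "'b \<Rightarrow> 'b list" where "j = restrict (\<lambda>a. [a]) (garr \<Phi>)"
  \<comment> \<open>Stated for every \<open>U\<close> above \<open>T\<close> because it is applied
    twice: existence at \<open>U = T\<close>, uniqueness at the set of all arrows.\<close>
  have ext: "\<exists>!k. k \<in> extensional (garr \<Phi>) \<and>
      groupoid_morphism \<Phi> (subgroupoid_copy \<Phi> U) (\<lambda>x. x) k \<and> (\<forall>a \<in> Xs. k a = [a])"
    if "groupoid (subgroupoid_copy \<Phi> U)" "T \<subseteq> U" for U
    by (rule free[unfolded free_groupoid_on_def, THEN conjunct2, THEN conjunct2, rule_format])
       (use that T(2) in \<open>auto simp: subgroupoid_copy_def garrows_def\<close>)
  obtain k where k: "k \<in> extensional (garr \<Phi>)"
      "groupoid_morphism \<Phi> (subgroupoid_copy \<Phi> T) (\<lambda>x. x) k" "\<forall>a \<in> Xs. k a = [a]"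
    using ext[OF subgroupoid_copy_groupoid[OF T(1) ids cmps invs]] by blast
  have "groupoid_morphism \<Phi> (subgroupoid_copy \<Phi> (garr \<Phi>)) (\<lambda>x. x) k"
    using k(2) T(1) by (simp add: groupoid_morphism_def garrows_def subgroupoid_copy_def) blast
  moreover have "groupoid_morphism \<Phi> (subgroupoid_copy \<Phi> (garr \<Phi>)) (\<lambda>x. x) j"
    by (auto simp: groupoid_morphism_def garrows_def subgroupoid_copy_def j_def id_arr cmp_arr)
  moreover have "\<forall>a \<in> Xs. j a = [a]" using T by (auto simp: j_def)
  moreover have "j \<in> extensional (garr \<Phi>)" by (simp add: j_def)
  moreover have "groupoid (subgroupoid_copy \<Phi> (garr \<Phi>))"
    by (rule subgroupoid_copy_groupoid) (auto simp: id_arr cmp_arr ginv_props)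
  ultimately have kj: "k = j" using ext[OF _ T(1)] k(1,3) by blast
  show ?thesis
  proof (intro equalityI T subsetI)
    fix a assume a: "a \<in> garr \<Phi>"
    then have "k a \<in> (\<lambda>a. [a]) ` T"
      using k(2) by (auto simp: groupoid_morphism_def garrows_def subgroupoid_copy_def)
    then show "a \<in> T" using a by (auto simp: kj j_def)
  qed
qed

section \<open>Copies of subgroups with an action\<close>

text \<open>The group structure of \<open>T\<close> transported along \<open>j\<close>;
  \<open>the_inv j\<close> is meaningful only for injective \<open>j\<close> and on the range of
  \<open>j\<close>. The operations do not mention \<open>T\<close>, so copies of different subgroups
  of \<open>M\<close> differ only in their carriers.\<close>

definition subgroup_copy :: "('m \<Rightarrow> 'n) \<Rightarrow> 'm monoid \<Rightarrow> 'm set \<Rightarrow> 'n monoid" where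
  "subgroup_copy j M T = \<lparr>carrier = j ` T, monoid.mult = (\<lambda>a b. j (the_inv j a \<otimes>\<^bsub>M\<^esub> the_inv j b)),
     monoid.one = j \<one>\<^bsub>M\<^esub>\<rparr>"

lemma group_subgroup_copy:
  assumes "group M" "subgroup T M" "inj j"
  shows "group (subgroup_copy j M T)"
proof -
  interpret M: group M by fact
  interpret T: subgroup T M by fact
  show ?thesis
  proof (rule groupI)
    fix a assume "a \<in> carrier (subgroup_copy j M T)"
    then obtain t where t: "a = j t" "t \<in> T" by (auto simp: subgroup_copy_def)
    show "\<exists>b \<in> carrier (subgroup_copy j M T). b \<otimes>\<^bsub>subgroup_copy j M T\<^esub> a = \<one>\<^bsub>subgroup_copy j M T\<^esub>"
      by (rule bexI[of _ "j (inv\<^bsub>M\<^esub> t)"])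
         (use t \<open>inj j\<close> in \<open>auto simp: subgroup_copy_def the_inv_f_f\<close>)
  qed (use \<open>inj j\<close> in \<open>auto simp: subgroup_copy_def the_inv_f_f M.m_assoc\<close>)
qed

lemma inv_subgroup_copy:
  assumes "group M" "subgroup T M" "inj j" "t \<in> T"
  shows "inv\<^bsub>subgroup_copy j M T\<^esub> (j t) = j (inv\<^bsub>M\<^esub> t)"
proof -
  interpret M: group M by fact
  interpret T: subgroup T M by fact
  show ?thesis
    by (rule group.inv_equality[OF group_subgroup_copy[OF assms(1-3)]])
       (use assms in \<open>auto simp: subgroup_copy_def the_inv_f_f\<close>)
qed

text \<open>The copies live on an arbitrary type, so that they can be the test objects of the
  universal properties.\<close>

locale subaction = groupoid_action \<Phi> M act
  for \<Phi> :: "('o, 'a) groupoid" and M :: "'o \<Rightarrow> 'm monoid" and act +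
  fixes T :: "'o \<Rightarrow> 'm set" and j :: "'m \<Rightarrow> 'n"
  assumes subgroups: "x \<in> gobj \<Phi> \<Longrightarrow> subgroup (T x) (M x)"
    and act_closed: "\<lbrakk>u \<in> garr \<Phi>; t \<in> T (gsrc \<Phi> u)\<rbrakk> \<Longrightarrow> act t u \<in> T (gtgt \<Phi> u)"
    and inj_j: "inj j"
begin

abbreviation copy :: "'o \<Rightarrow> 'n monoid" where
  "copy x \<equiv> subgroup_copy j (M x) (T x)"

abbreviation copy_act :: "'n \<Rightarrow> 'a \<Rightarrow> 'n" where
  "copy_act n u \<equiv> j (act (the_inv j n) u)"

lemma mem_carrier: "x \<in> gobj \<Phi> \<Longrightarrow> t \<in> T x \<Longrightarrow> t \<in> carrier (M x)"
  using subgroups subgroup.mem_carrier by metis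

lemma copy_action: "groupoid_action \<Phi> copy copy_act"
proof (intro groupoid_action.intro groupoid_action_axioms.intro groupoid_axioms)
  fix x assume x: "x \<in> gobj \<Phi>"
  show "group (copy x)"
    by (rule group_subgroup_copy[OF groups[OF x] subgroups[OF x] inj_j])
  show "copy_act n (gid \<Phi> x) = n" if "n \<in> carrier (copy x)" for n
    using that x by (auto simp: subgroup_copy_def the_inv_f_f[OF inj_j] act_id mem_carrier)
next
  show "disjoint_family_on (\<lambda>x. carrier (copy x)) (gobj \<Phi>)"
    unfolding disjoint_family_on_def
  proof (intro ballI impI)
    fix x y assume "x \<in> gobj \<Phi>" "y \<in> gobj \<Phi>" "x \<noteq> y"
    then have "T x \<inter> T y = {}"
      using disjoint_family_onD[OF disjoint, of x y] mem_carrier by blast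
    then show "carrier (copy x) \<inter> carrier (copy y) = {}"
      using image_Int[OF inj_j, of "T x" "T y"] by (simp add: subgroup_copy_def)
  qed
next
  fix u assume u: "u \<in> garr \<Phi>"
  then show "(\<lambda>n. copy_act n u) \<in> hom (copy (gsrc \<Phi> u)) (copy (gtgt \<Phi> u))"
    using hom_mult[OF act_hom[OF u]]
    by (auto simp: hom_def subgroup_copy_def the_inv_f_f[OF inj_j] act_closed mem_carrier src_closed)
  show "copy_act n (gcmp \<Phi> u v) = copy_act (copy_act n u) v"
    if "v \<in> garr \<Phi>" "gtgt \<Phi> u = gsrc \<Phi> v" "n \<in> carrier (copy (gsrc \<Phi> u))" for v n
    using that u by (auto simp: subgroup_copy_def the_inv_f_f[OF inj_j] act_cmp mem_carrier src_closed)
qed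

lemma copy_module:
  assumes "groupoid_module \<Phi> M act"
  shows "groupoid_module \<Phi> copy copy_act"
proof -
  interpret copy: groupoid_action \<Phi> copy copy_act by (rule copy_action)
  interpret M: groupoid_module \<Phi> M act by fact
  show ?thesis
  proof (intro groupoid_module.intro groupoid_module_axioms.intro copy_action)
    fix x assume x: "x \<in> gobj \<Phi>"
    interpret Mx: comm_group "M x" by (rule M.commutative[OF x])
    interpret Nx: group "copy x" by (rule copy.groups[OF x])
    show "comm_group (copy x)"
      by (rule Nx.group_comm_groupI)
         (use x in \<open>auto simp: subgroup_copy_def the_inv_f_f[OF inj_j] mem_carrier Mx.m_comm\<close>)
  qed
qed

lemma copy_crossed_module:
  assumes "crossed_module \<Phi> M act \<mu>"
  shows "crossed_module \<Phi> copy copy_act (\<lambda>n. \<mu> (the_inv j n))"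
proof -
  interpret copy: groupoid_action \<Phi> copy copy_act by (rule copy_action)
  interpret M: crossed_module \<Phi> M act \<mu> by fact
  show ?thesis
  proof (intro crossed_module.intro crossed_module_axioms.intro copy_action)
    fix x assume x: "x \<in> gobj \<Phi>"
    show "(\<lambda>n. \<mu> (the_inv j n)) \<in> hom (copy x) (vertex_group \<Phi> x)"
      using M.boundary_hom[OF x] x
      by (auto simp: hom_def Pi_iff subgroup_copy_def the_inv_f_f[OF inj_j] mem_carrier)
    show "inv\<^bsub>copy x\<^esub> n \<otimes>\<^bsub>copy x\<^esub> m \<otimes>\<^bsub>copy x\<^esub> n = copy_act m (\<mu> (the_inv j n))"
      if mn: "m \<in> carrier (copy x)" "n \<in> carrier (copy x)" for m n
    proof -
      obtain s t where st: "m = j s" "s \<in> T x" "n = j t" "t \<in> T x"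
        using mn by (auto simp: subgroup_copy_def)
      show ?thesis
        \<comment> \<open>Once the inverse of the copy is expressed by the inverse in
          \<open>M x\<close>, the identity is the Peiffer law of \<open>M\<close> transported by
          \<open>j\<close>.\<close>
        using st x by (simp add: inv_subgroup_copy[OF groups[OF x] subgroups[OF x] inj_j])
          (simp add: subgroup_copy_def the_inv_f_f[OF inj_j] M.peiffer[symmetric] mem_carrier)
    qed
  next
    fix u n assume "u \<in> garr \<Phi>" "n \<in> carrier (copy (gsrc \<Phi> u))"
    then show "\<mu> (the_inv j (copy_act n u)) = gcmp \<Phi> (gcmp \<Phi> (ginv \<Phi> u) (\<mu> (the_inv j n))) u"
      by (auto simp: subgroup_copy_def the_inv_f_f[OF inj_j] M.equivariant mem_carrier src_closed)
  qed
qed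

end

text \<open>Provides the copy of all of \<open>M\<close> as a second test object, the one in which
  uniqueness is applied.\<close>

lemma subaction_full:
  assumes "groupoid_action \<Phi> M act" "inj j"
  shows "subaction \<Phi> M act (\<lambda>x. carrier (M x)) j"
proof -
  interpret groupoid_action \<Phi> M act by fact
  show ?thesis
    by (intro subaction.intro subaction_axioms.intro assms)
       (use act_hom in \<open>auto simp: groups group.subgroup_self hom_def\<close>)
qed

text \<open>The map with which uniqueness compares. \<open>copy_act\<close> does not depend on
  \<open>T\<close>, so it also acts on the copy of all of \<open>M\<close>; the restriction makes
  the map extensional.\<close>

lemma (in subaction) action_morphism_full:
  "action_morphism \<Phi> M act (\<lambda>x. subgroup_copy j (M x) (carrier (M x))) copy_act
     (restrict j (elems \<Phi> M))"
  unfolding action_morphism_def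
proof (intro conjI ballI homI)
  fix x m n assume x: "x \<in> gobj \<Phi>" and m: "m \<in> carrier (M x)" and n: "n \<in> carrier (M x)"
  interpret group "M x" by (rule groups[OF x])
  have "m \<in> elems \<Phi> M" "n \<in> elems \<Phi> M" "m \<otimes>\<^bsub>M x\<^esub> n \<in> elems \<Phi> M"
    using x m n m_closed[OF m n] by blast+
  then show "restrict j (elems \<Phi> M) (m \<otimes>\<^bsub>M x\<^esub> n) =
      restrict j (elems \<Phi> M) m \<otimes>\<^bsub>subgroup_copy j (M x) (carrier (M x))\<^esub> restrict j (elems \<Phi> M) n"
    by (simp only: restrict_apply if_True) (simp add: subgroup_copy_def the_inv_f_f[OF inj_j])
next
  fix x m assume "x \<in> gobj \<Phi>" "m \<in> carrier (M x)"
  then show "restrict j (elems \<Phi> M) m \<in> carrier (subgroup_copy j (M x) (carrier (M x)))"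
    by (auto simp: subgroup_copy_def)
next
  fix u m assume u: "u \<in> garr \<Phi>" and m: "m \<in> carrier (M (gsrc \<Phi> u))"
  have "act m u \<in> carrier (M (gtgt \<Phi> u))" by (rule hom_in_carrier[OF act_hom[OF u] m])
  then have "m \<in> elems \<Phi> M" "act m u \<in> elems \<Phi> M"
    using src_closed[OF u] tgt_closed[OF u] m by blast+
  then show "restrict j (elems \<Phi> M) (act m u) = copy_act (restrict j (elems \<Phi> M) m) u"
    by (simp only: restrict_apply if_True) (simp add: the_inv_f_f[OF inj_j])
qed

text \<open>This is composition with the inclusion of the copy of \<open>T\<close> in the copy of
  \<open>M\<close>. As the two copies share their multiplication, only membership in the larger
  carrier has to be checked.\<close>

lemma (in subaction) action_morphism_copyD:
  assumes "action_morphism \<Phi> M act copy act' k"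
  shows "action_morphism \<Phi> M act (\<lambda>x. subgroup_copy j (M x) (carrier (M x))) act' k"
proof -
  have "k \<in> hom (M x) (subgroup_copy j (M x) (carrier (M x)))"
    if "k \<in> hom (M x) (copy x)" "x \<in> gobj \<Phi>" for x
    using that mem_carrier by (simp add: hom_def subgroup_copy_def Pi_iff) blast
  then show ?thesis using assms by (auto simp: action_morphism_def)
qed

text \<open>Such a morphism sends \<open>m\<close> to \<open>j m\<close>, which then lies in
  \<open>j\<close> applied to \<open>T x\<close>, and injectivity of \<open>j\<close> puts
  \<open>m\<close> in \<open>T x\<close>.\<close>

lemma (in subaction) eq_carrier_if_morphism:
  assumes "action_morphism \<Phi> M act copy copy_act (restrict j (elems \<Phi> M))" "x \<in> gobj \<Phi>"
  shows "T x = carrier (M x)"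
proof (intro equalityI subsetI)
  fix m assume m: "m \<in> carrier (M x)"
  then have "restrict j (elems \<Phi> M) m = j m" using assms(2) by auto
  moreover have "restrict j (elems \<Phi> M) m \<in> carrier (copy x)"
    using assms unfolding action_morphism_def by (intro hom_in_carrier[OF _ m]) blast
  ultimately have "j m \<in> j ` T x" by (simp only: subgroup_copy_def partial_object.select_convs)
  then show "m \<in> T x" by (simp only: inj_image_mem_iff[OF inj_j])
qed (use assms(2) mem_carrier in auto)

section \<open>Generation of free modules and free crossed modules\<close>

lemma free_groupoid_module_on_submodule:
  assumes free: "free_groupoid_module_on \<Phi> M act Xs"
    and subgroups: "\<And>x. x \<in> gobj \<Phi> \<Longrightarrow> subgroup (T x) (M x)"
    and act_closed: "\<And>u t. \<lbrakk>u \<in> garr \<Phi>; t \<in> T (gsrc \<Phi> u)\<rbrakk> \<Longrightarrow> act t u \<in> T (gtgt \<Phi> u)"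
    and Xs: "\<And>x. x \<in> gobj \<Phi> \<Longrightarrow> Xs \<inter> carrier (M x) \<subseteq> T x"
    and x: "x \<in> gobj \<Phi>"
  shows "T x = carrier (M x)"
proof -
  interpret M: groupoid_module \<Phi> M act using free by (simp add: free_groupoid_module_on_def)
  \<comment> \<open>This embeds the elements of \<open>M\<close> in the type of lists over which the
    test modules range.\<close>
  define j :: "'c \<Rightarrow> ('b + 'c) list" where "j = (\<lambda>m. [Inr m])"
  have "inj j" by (auto simp: j_def inj_def)
  interpret T: subaction \<Phi> M act T j
    by (intro subaction.intro subaction_axioms.intro M.groupoid_action_axioms subgroups act_closed \<open>inj j\<close>)
  interpret U: subaction \<Phi> M act "\<lambda>x. carrier (M x)" j
    by (rule subaction_full[OF M.groupoid_action_axioms \<open>inj j\<close>])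
  have Xs_elems: "Xs \<subseteq> elems \<Phi> M" using free by (simp add: free_groupoid_module_on_def)
  have ext: "\<exists>!k. k \<in> extensional (elems \<Phi> M) \<and> action_morphism \<Phi> M act N act' k \<and>
      (\<forall>s \<in> Xs. k s = j s)"
    if "groupoid_module \<Phi> N act'" "\<And>x s. \<lbrakk>x \<in> gobj \<Phi>; s \<in> Xs; s \<in> carrier (M x)\<rbrakk> \<Longrightarrow> j s \<in> carrier (N x)"
    for N :: "'a \<Rightarrow> ('b + 'c) list monoid" and act'
    using free that by (auto simp: free_groupoid_module_on_def)
  obtain k where k: "k \<in> extensional (elems \<Phi> M)" "action_morphism \<Phi> M act T.copy T.copy_act k"
      "\<forall>s \<in> Xs. k s = j s"
    using ext[OF T.copy_module[OF M.groupoid_module_axioms]] Xs by (auto simp: subgroup_copy_def)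
  \<comment> \<open>In the copy of all of \<open>M\<close> both \<open>k\<close> and the restriction
    of \<open>j\<close> extend the same values on the generators, so they coincide.\<close>
  have "\<exists>!k. k \<in> extensional (elems \<Phi> M) \<and> action_morphism \<Phi> M act U.copy T.copy_act k \<and>
      (\<forall>s \<in> Xs. k s = j s)"
    by (rule ext[OF U.copy_module[OF M.groupoid_module_axioms]]) (auto simp: subgroup_copy_def)
  moreover have "restrict j (elems \<Phi> M) \<in> extensional (elems \<Phi> M)" by simp
  moreover have "\<forall>s \<in> Xs. restrict j (elems \<Phi> M) s = j s" using Xs_elems by auto
  ultimately have k_eq: "k = restrict j (elems \<Phi> M)"
    using k(1,3) T.action_morphism_full T.action_morphism_copyD[OF k(2)] by blast
  show ?thesis using k(2) unfolding k_eq by (rule T.eq_carrier_if_morphism[OF _ x])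
qed

text \<open>The argument is the one for modules; in addition the induced map has to be compatible
  with the boundaries.\<close>

lemma free_crossed_module_on_submodule:
  fixes \<iota> :: "'s \<Rightarrow> 'm" and \<Phi> :: "('o, 'a) groupoid"
  assumes free: "free_crossed_module_on \<Phi> M act \<mu> S w \<iota>"
    and subgroups: "\<And>x. x \<in> gobj \<Phi> \<Longrightarrow> subgroup (T x) (M x)"
    and act_closed: "\<And>u t. \<lbrakk>u \<in> garr \<Phi>; t \<in> T (gsrc \<Phi> u)\<rbrakk> \<Longrightarrow> act t u \<in> T (gtgt \<Phi> u)"
    and gens: "\<And>x s. \<lbrakk>x \<in> gobj \<Phi>; s \<in> S x\<rbrakk> \<Longrightarrow> \<iota> s \<in> T x"
    and x: "x \<in> gobj \<Phi>"
  shows "T x = carrier (M x)"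
proof -
  interpret M: crossed_module \<Phi> M act \<mu> using free by (simp add: free_crossed_module_on_def)
  define j :: "'m \<Rightarrow> ('s + 'a + 'm) list" where "j = (\<lambda>m. [Inr (Inr m)])"
  have "inj j" by (auto simp: j_def inj_def)
  interpret T: subaction \<Phi> M act T j
    by (intro subaction.intro subaction_axioms.intro M.groupoid_action_axioms subgroups act_closed \<open>inj j\<close>)
  interpret U: subaction \<Phi> M act "\<lambda>x. carrier (M x)" j
    by (rule subaction_full[OF M.groupoid_action_axioms \<open>inj j\<close>])
  \<comment> \<open>The same boundary serves both copies, so enlarging the target of
    \<open>k\<close> preserves its compatibility with \<mu>.\<close>
  let ?\<nu> = "\<lambda>n. \<mu> (the_inv j n)"
  have S: "w s \<in> garrows \<Phi> x x" "\<iota> s \<in> carrier (M x)" "\<mu> (\<iota> s) = w s"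
    if "x \<in> gobj \<Phi>" "s \<in> S x" for x s
    using free that by (auto simp: free_crossed_module_on_def)
  have ext: "\<exists>!k. k \<in> extensional (elems \<Phi> M) \<and> action_morphism \<Phi> M act N act' k \<and>
      (\<forall>m \<in> elems \<Phi> M. ?\<nu> (k m) = \<mu> m) \<and> (\<forall>x \<in> gobj \<Phi>. \<forall>s \<in> S x. k (\<iota> s) = j (\<iota> s))"
    if "crossed_module \<Phi> N act' ?\<nu>" "\<And>x s. \<lbrakk>x \<in> gobj \<Phi>; s \<in> S x\<rbrakk> \<Longrightarrow> j (\<iota> s) \<in> carrier (N x)"
    for N :: "'o \<Rightarrow> ('s + 'a + 'm) list monoid" and act'
    by (rule free[unfolded free_crossed_module_on_def, THEN conjunct2, THEN conjunct2, rule_format,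
          where \<nu> = ?\<nu> and f = "\<lambda>s. j (\<iota> s)"])
       (use that S in \<open>auto simp: the_inv_f_f[OF \<open>inj j\<close>]\<close>)
  obtain k where k: "k \<in> extensional (elems \<Phi> M)" "action_morphism \<Phi> M act T.copy T.copy_act k"
      "\<forall>m \<in> elems \<Phi> M. ?\<nu> (k m) = \<mu> m" "\<forall>x \<in> gobj \<Phi>. \<forall>s \<in> S x. k (\<iota> s) = j (\<iota> s)"
    using ext[OF T.copy_crossed_module[OF M.crossed_module_axioms]] gens
    by (auto simp: subgroup_copy_def)
  have "\<exists>!k. k \<in> extensional (elems \<Phi> M) \<and> action_morphism \<Phi> M act U.copy T.copy_act k \<and>
      (\<forall>m \<in> elems \<Phi> M. ?\<nu> (k m) = \<mu> m) \<and> (\<forall>x \<in> gobj \<Phi>. \<forall>s \<in> S x. k (\<iota> s) = j (\<iota> s))"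
    by (rule ext[OF U.copy_crossed_module[OF M.crossed_module_axioms]])
       (use S in \<open>auto simp: subgroup_copy_def\<close>)
  moreover have "restrict j (elems \<Phi> M) \<in> extensional (elems \<Phi> M)" by simp
  moreover have "\<forall>x \<in> gobj \<Phi>. \<forall>s \<in> S x. restrict j (elems \<Phi> M) (\<iota> s) = j (\<iota> s)"
    using S by auto
  moreover have "\<forall>m \<in> elems \<Phi> M. ?\<nu> (restrict j (elems \<Phi> M) m) = \<mu> m"
    by (simp add: the_inv_f_f[OF \<open>inj j\<close>])
  ultimately have k_eq: "k = restrict j (elems \<Phi> M)"
    using k(1,3,4) T.action_morphism_full T.action_morphism_copyD[OF k(2)] by blast
  show ?thesis using k(2) unfolding k_eq by (rule T.eq_carrier_if_morphism[OF _ x])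
qed

section \<open>Free crossed resolutions and their universal covers\<close>

locale resolution =
  fixes m :: nat and G :: "'g monoid" and pt :: 'o and C :: "('o, 'c) crossed_complex"
    and \<phi> :: "'c \<Rightarrow> 'g"
  assumes resolution: "free_crossed_resolution m G pt C \<phi>"
begin

abbreviation F :: "'c monoid" where "F \<equiv> vertex_group (cgrpd C) pt"

abbreviation A :: "nat \<Rightarrow> 'c monoid" where "A n \<equiv> cfam C n pt"

abbreviation kern :: "nat \<Rightarrow> 'c set" where
  "kern n \<equiv> kernel (A n) (dim_group C (n - 1) pt) (cbd C n)"

sublocale C1: groupoid "cgrpd C"
  using resolution by (simp add: free_crossed_resolution_def truncated_crossed_complex_def)

lemma gobj_C [simp]: "gobj (cgrpd C) = {pt}"
  using resolution by (simp add: free_crossed_resolution_def)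

text \<open>As \<open>pt\<close> is the only object, these rules turn statements about arrows of the
  groupoid into statements about the group \<open>F\<close>.\<close>

lemma vertex_group_C:
  "garr (cgrpd C) = carrier F" "gcmp (cgrpd C) = (\<otimes>\<^bsub>F\<^esub>)" "gid (cgrpd C) pt = \<one>\<^bsub>F\<^esub>"
  "u \<in> carrier F \<Longrightarrow> gsrc (cgrpd C) u = pt" "u \<in> carrier F \<Longrightarrow> gtgt (cgrpd C) u = pt"
  using C1.src_closed C1.tgt_closed by (auto simp: vertex_group_def garrows_def)

declare vertex_group_C [simp]

sublocale F: group F
  using resolution by (auto simp: free_crossed_resolution_def free_group_on_def)

sublocale G: group G
  using resolution by (simp add: free_crossed_resolution_def)

sublocale \<phi>: group_hom F G \<phi>
  using resolution
  by unfold_locales (simp add: free_crossed_resolution_def epi_def)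

lemma phi_surj: "\<phi> ` carrier F = carrier G"
  using resolution by (simp add: free_crossed_resolution_def epi_def)

lemma ginv_C [simp]: "u \<in> carrier F \<Longrightarrow> ginv (cgrpd C) u = inv\<^bsub>F\<^esub> u"
  by (rule C1.ginv_equality) simp_all

lemma complex: "truncated_crossed_complex m C"
  using resolution by (simp add: free_crossed_resolution_def)

lemma crossed: "2 \<le> m \<Longrightarrow> crossed_module (cgrpd C) (cfam C 2) (cact C 2) (cbd C 2)"
  using complex by (simp add: truncated_crossed_complex_def)

lemma module: "3 \<le> n \<Longrightarrow> n \<le> m \<Longrightarrow> groupoid_module (cgrpd C) (cfam C n) (cact C n)"
  using complex by (simp add: truncated_crossed_complex_def)

lemma action: "2 \<le> n \<Longrightarrow> n \<le> m \<Longrightarrow> groupoid_action (cgrpd C) (cfam C n) (cact C n)"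
  using crossed module[of n]
  by (cases "n = 2") (auto simp: crossed_module_def groupoid_module_def)

lemma group_A: "2 \<le> n \<Longrightarrow> n \<le> m \<Longrightarrow> group (A n)"
  using groupoid_action.groups[OF action] by simp

lemma act_hom: "\<lbrakk>2 \<le> n; n \<le> m; u \<in> carrier F\<rbrakk> \<Longrightarrow> (\<lambda>c. cact C n c u) \<in> hom (A n) (A n)"
  using groupoid_action.act_hom[OF action, of n u] by simp

lemma act_closed:
  "\<lbrakk>2 \<le> n; n \<le> m; u \<in> carrier F; c \<in> carrier (A n)\<rbrakk> \<Longrightarrow> cact C n c u \<in> carrier (A n)"
  using hom_in_carrier[OF act_hom] by simp

lemma act_mult:
  "\<lbrakk>2 \<le> n; n \<le> m; u \<in> carrier F; c \<in> carrier (A n); d \<in> carrier (A n)\<rbrakk>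
    \<Longrightarrow> cact C n (c \<otimes>\<^bsub>A n\<^esub> d) u = cact C n c u \<otimes>\<^bsub>A n\<^esub> cact C n d u"
  using hom_mult[OF act_hom] by simp

lemma act_one: "\<lbrakk>2 \<le> n; n \<le> m; c \<in> carrier (A n)\<rbrakk> \<Longrightarrow> cact C n c \<one>\<^bsub>F\<^esub> = c"
  using groupoid_action.act_id[OF action, of n pt c] by simp

lemma act_cmp:
  "\<lbrakk>2 \<le> n; n \<le> m; u \<in> carrier F; v \<in> carrier F; c \<in> carrier (A n)\<rbrakk>
    \<Longrightarrow> cact C n c (u \<otimes>\<^bsub>F\<^esub> v) = cact C n (cact C n c u) v"
  using groupoid_action.act_cmp[OF action, of n u v c] by simp

lemma boundary_hom: "2 \<le> n \<Longrightarrow> n \<le> m \<Longrightarrow> cbd C n \<in> hom (A n) (dim_group C (n - 1) pt)"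
  using crossed_module.boundary_hom[OF crossed, of pt] complex
  by (cases "n = 2") (auto simp: dim_group_def truncated_crossed_complex_def action_morphism_def)

lemma boundary2_hom: "2 \<le> m \<Longrightarrow> cbd C 2 \<in> hom (A 2) F"
  using boundary_hom[of 2] by (simp add: dim_group_def)

lemma boundary3_hom: "3 \<le> n \<Longrightarrow> n \<le> m \<Longrightarrow> cbd C n \<in> hom (A n) (A (n - 1))"
  using boundary_hom[of n] by (simp add: dim_group_def split: if_splits)

lemma boundary2_act: "\<lbrakk>2 \<le> m; u \<in> carrier F; c \<in> carrier (A 2)\<rbrakk>
    \<Longrightarrow> cbd C 2 (cact C 2 c u) = inv\<^bsub>F\<^esub> u \<otimes>\<^bsub>F\<^esub> cbd C 2 c \<otimes>\<^bsub>F\<^esub> u"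
  using crossed_module.equivariant[OF crossed, of u c] by simp

lemma peiffer: "\<lbrakk>2 \<le> m; c \<in> carrier (A 2); d \<in> carrier (A 2)\<rbrakk>
    \<Longrightarrow> inv\<^bsub>A 2\<^esub> d \<otimes>\<^bsub>A 2\<^esub> c \<otimes>\<^bsub>A 2\<^esub> d = cact C 2 c (cbd C 2 d)"
  using crossed_module.peiffer[OF crossed, of pt c d] by simp

lemma boundary_act: "\<lbrakk>3 \<le> n; n \<le> m; u \<in> carrier F; c \<in> carrier (A n)\<rbrakk>
    \<Longrightarrow> cbd C n (cact C n c u) = cact C (n - 1) (cbd C n c) u"
  using complex by (auto simp: truncated_crossed_complex_def action_morphism_def)

lemma boundary_boundary: "\<lbrakk>3 \<le> n; n \<le> m; c \<in> carrier (A n)\<rbrakk>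
    \<Longrightarrow> cbd C (n - 1) (cbd C n c) = \<one>\<^bsub>dim_group C (n - 2) pt\<^esub>"
  using complex by (auto simp: truncated_crossed_complex_def)

lemma kernel_phi: "2 \<le> m \<Longrightarrow> kernel F G \<phi> = cbd C 2 ` carrier (A 2)"
  using resolution by (simp add: free_crossed_resolution_def)

lemma group_dim: "1 \<le> n \<Longrightarrow> n \<le> m \<Longrightarrow> group (dim_group C n pt)"
  by (cases "n = 1") (auto simp: dim_group_def group_A F.is_group)

lemma boundary_group_hom: "2 \<le> n \<Longrightarrow> n \<le> m \<Longrightarrow> group_hom (A n) (dim_group C (n - 1) pt) (cbd C n)"
  by (intro group_hom.intro group_hom_axioms.intro group_A group_dim boundary_hom) auto

section \<open>The kernel of the boundary as a module over \<open>G\<close>\<close>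

text \<open>In dimension 2 the Peiffer law says that conjugating \<open>c\<close> by
  \<open>z\<close> is acting by the boundary of \<open>z\<close>, which is trivial. In higher
  dimensions the groups are abelian.\<close>

lemma kern_comm:
  assumes "2 \<le> n" "n \<le> m" "z \<in> kern n" "c \<in> carrier (A n)"
  shows "z \<otimes>\<^bsub>A n\<^esub> c = c \<otimes>\<^bsub>A n\<^esub> z"
proof (cases "n = 2")
  case True
  interpret A2: group "A 2" using group_A assms True by simp
  have z: "z \<in> carrier (A 2)" "cbd C 2 z = \<one>\<^bsub>F\<^esub>"
    using assms True by (auto simp: kernel_def dim_group_def)
  have "inv\<^bsub>A 2\<^esub> z \<otimes>\<^bsub>A 2\<^esub> c \<otimes>\<^bsub>A 2\<^esub> z = c"
    using peiffer[of c z] act_one[of 2 c] assms z True by simp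
  then have "inv\<^bsub>A 2\<^esub> z \<otimes>\<^bsub>A 2\<^esub> (c \<otimes>\<^bsub>A 2\<^esub> z) = c"
    using assms z True by (simp add: A2.m_assoc)
  then show ?thesis
    using A2.inv_solve_left[of c z "c \<otimes>\<^bsub>A 2\<^esub> z"] assms z True by simp
next
  case False
  then interpret An: comm_group "A n"
    using groupoid_module.commutative[OF module, of n pt] assms by simp
  show ?thesis using assms by (simp add: kernel_def An.m_comm)
qed

text \<open>In dimension 2 the boundary of \<open>z\<close> acted on by \<open>u\<close> is a
  conjugate of 1. In higher dimensions the boundary commutes with the action, and the action of
  \<open>u\<close> is a homomorphism and fixes 1.\<close>

lemma kern_act:
  assumes "2 \<le> n" "n \<le> m" "z \<in> kern n" "u \<in> carrier F"
  shows "cact C n z u \<in> kern n"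
proof -
  have z: "z \<in> carrier (A n)" "cbd C n z = \<one>\<^bsub>dim_group C (n - 1) pt\<^esub>"
    using assms by (auto simp: kernel_def)
  have "cbd C n (cact C n z u) = \<one>\<^bsub>dim_group C (n - 1) pt\<^esub>"
  proof (cases "n = 2")
    case True
    then show ?thesis using boundary2_act[of u z] assms z by (simp add: dim_group_def)
  next
    case False
    interpret group_hom "A (n - 1)" "A (n - 1)" "\<lambda>c. cact C (n - 1) c u"
      by (intro group_hom.intro group_hom_axioms.intro group_A act_hom) (use assms False in auto)
    have "dim_group C (n - 1) pt = A (n - 1)" using assms False by (simp add: dim_group_def)
    then show ?thesis using boundary_act[of n u z] hom_one assms z False by simp
  qed
  then show ?thesis using act_closed assms z by (simp add: kernel_def)
qed

lemma trivial_act: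
  assumes "3 \<le> n" "n \<le> m" "c \<in> carrier (A n)" "v \<in> kernel F G \<phi>"
  shows "cact C n c v = c"
proof -
  obtain d where "d \<in> carrier (A 2)" "v = cbd C 2 d"
    using kernel_phi assms by auto
  then show ?thesis
    using complex assms by (simp add: truncated_crossed_complex_def)
qed

text \<open>By exactness \<open>v\<close> is the boundary of some \<open>d\<close>. In dimension 2
  the Peiffer law makes its action on \<open>z\<close> conjugation by \<open>d\<close>, which fixes
  the central element \<open>z\<close>.\<close>

lemma trivial_act_kern:
  assumes "2 \<le> n" "n \<le> m" "z \<in> kern n" "v \<in> kernel F G \<phi>"
  shows "cact C n z v = z"
proof (cases "n = 2")
  case True
  interpret A2: group "A 2" using group_A assms True by simp
  obtain d where d: "d \<in> carrier (A 2)" "v = cbd C 2 d"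
    using kernel_phi assms by auto
  have "z \<in> carrier (A 2)" using assms True by (simp add: kernel_def)
  moreover have "z \<otimes>\<^bsub>A 2\<^esub> d = d \<otimes>\<^bsub>A 2\<^esub> z" using kern_comm[of n z d] assms True d by simp
  ultimately show ?thesis
    using peiffer[of z d] A2.inv_solve_left'[of z d "z \<otimes>\<^bsub>A 2\<^esub> d"] assms True d by (simp add: A2.m_assoc)
next
  case False
  then show ?thesis using trivial_act assms by (simp add: kernel_def)
qed

text \<open>Where the kernel of \<open>\<phi>\<close> acts trivially, the chosen preimages in \<open>induced_act\<close> do not matter.\<close>

lemma act_eq_if_phi_eq:
  assumes "2 \<le> n" "n \<le> m" "c \<in> carrier (A n)" "\<And>v. v \<in> kernel F G \<phi> \<Longrightarrow> cact C n c v = c"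
    and "u \<in> carrier F" "v \<in> carrier F" "\<phi> u = \<phi> v"
  shows "cact C n c u = cact C n c v"
proof -
  have "u \<otimes>\<^bsub>F\<^esub> inv\<^bsub>F\<^esub> v \<in> kernel F G \<phi>" using assms by (simp add: kernel_def)
  then have "cact C n c (u \<otimes>\<^bsub>F\<^esub> inv\<^bsub>F\<^esub> v \<otimes>\<^bsub>F\<^esub> v) = cact C n c v"
    using assms act_cmp[of n "u \<otimes>\<^bsub>F\<^esub> inv\<^bsub>F\<^esub> v" v c] by simp
  then show ?thesis using assms by (simp add: F.m_assoc)
qed

lemma lift_phi:
  assumes "g \<in> carrier G"
  shows "inv_into (carrier F) \<phi> g \<in> carrier F" "\<phi> (inv_into (carrier F) \<phi> g) = g"
  using assms phi_surj by (auto intro: inv_into_into f_inv_into_f)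

text \<open>Both \<open>u\<close> and the chosen preimage of \<open>\<phi> u\<close> lie over the
  same element of \<open>G\<close>, and the kernel of \<phi> fixes \<open>z\<close>. The induced
  action can thus be computed with any lift.\<close>

lemma induced_act_phi:
  assumes "2 \<le> n" "n \<le> m" "z \<in> kern n" "u \<in> carrier F"
  shows "induced_act C \<phi> n z (\<phi> u) = cact C n z u"
  unfolding induced_act_def vertex_group_C
  by (rule act_eq_if_phi_eq)
     (use assms trivial_act_kern lift_phi[of "\<phi> u"] in \<open>auto simp: kernel_def\<close>)

text \<open>Every element of \<open>G\<close> lifts to \<open>F\<close>, so the laws of a
  \<open>G\<close>-module are the action laws of \<open>F\<close> restricted to the kernel.
  Commutativity is centrality of the kernel.\<close>

lemma kern_module:
  assumes n: "2 \<le> n" "n \<le> m"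
  shows "group_module G ((A n)\<lparr>carrier := kern n\<rparr>) (induced_act C \<phi> n)"
proof -
  interpret An: group "A n" by (rule group_A[OF n])
  have sub: "subgroup (kern n) (A n)"
    by (rule group_hom.subgroup_kernel[OF boundary_group_hom[OF n]])
  interpret K: group "(A n)\<lparr>carrier := kern n\<rparr>"
    by (rule subgroup.subgroup_is_group[OF sub An.is_group])
  have kern_carrier: "z \<in> carrier (A n)" if "z \<in> kern n" for z
    using that by (simp add: kernel_def)
  note lift = induced_act_phi[OF n]
  have ex_lift: "\<exists>u \<in> carrier F. \<phi> u = g" if "g \<in> carrier G" for g
    using lift_phi that by blast
  show ?thesis
  proof (intro groupoid_module.intro groupoid_module_axioms.intro groupoid_action.intro
      groupoid_action_axioms.intro)
    show "groupoid (group_groupoid G)"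
      by unfold_locales
         (auto simp: group_groupoid_def G.m_assoc intro!: bexI[of _ "inv\<^bsub>G\<^esub> _"])
    show "comm_group ((A n)\<lparr>carrier := kern n\<rparr>)" if "x \<in> gobj (group_groupoid G)" for x
      by (rule K.group_comm_groupI) (simp add: kern_comm[OF n] kern_carrier)
    show "group ((A n)\<lparr>carrier := kern n\<rparr>)" if "x \<in> gobj (group_groupoid G)" for x
      by (rule K.is_group)
    show "disjoint_family_on (\<lambda>x. carrier ((A n)\<lparr>carrier := kern n\<rparr>)) (gobj (group_groupoid G))"
      by (simp add: disjoint_family_on_def group_groupoid_def)
    show "(\<lambda>c. induced_act C \<phi> n c g) \<in> hom ((A n)\<lparr>carrier := kern n\<rparr>) ((A n)\<lparr>carrier := kern n\<rparr>)"
      if g: "g \<in> garr (group_groupoid G)" for g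
    proof -
      obtain u where u: "u \<in> carrier F" "g = \<phi> u"
        using g ex_lift[of g] by (auto simp: group_groupoid_def)
      show ?thesis
        using u kern_act[OF n] act_mult[OF n] subgroup.m_closed[OF sub]
        by (auto intro!: homI simp: lift kern_carrier)
    qed
    show "induced_act C \<phi> n z (gid (group_groupoid G) x) = z"
      if "x \<in> gobj (group_groupoid G)" "z \<in> carrier ((A n)\<lparr>carrier := kern n\<rparr>)" for x z
      using that lift[of z "\<one>\<^bsub>F\<^esub>"] act_one[OF n] by (simp add: group_groupoid_def kern_carrier)
    show "induced_act C \<phi> n z (gcmp (group_groupoid G) a b) =
        induced_act C \<phi> n (induced_act C \<phi> n z a) b"
      if abz: "a \<in> garr (group_groupoid G)" "b \<in> garr (group_groupoid G)"
        "z \<in> carrier ((A n)\<lparr>carrier := kern n\<rparr>)" for a b z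
    proof -
      obtain u v where uv: "u \<in> carrier F" "a = \<phi> u" "v \<in> carrier F" "b = \<phi> v"
        using abz ex_lift[of a] ex_lift[of b] by (auto simp: group_groupoid_def)
      show ?thesis
        using uv abz lift[of z "u \<otimes>\<^bsub>F\<^esub> v"] kern_act[OF n] act_cmp[OF n]
        by (simp add: group_groupoid_def lift kern_carrier)
    qed
  qed
qed

section \<open>The universal cover in coordinates\<close>

abbreviation D :: "('g, 'g \<times> 'c) crossed_complex" where "D \<equiv> universal_cover G pt C \<phi>"

lemma cover_groupoid_simps [simp]:
  "gobj (cgrpd D) = carrier G" "garr (cgrpd D) = carrier G \<times> carrier F" "gsrc (cgrpd D) = fst"
  "gtgt (cgrpd D) (g, u) = g \<otimes>\<^bsub>G\<^esub> \<phi> u" "gid (cgrpd D) g = (g, \<one>\<^bsub>F\<^esub>)"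
  "gcmp (cgrpd D) (g, u) (g', v) = (g, u \<otimes>\<^bsub>F\<^esub> v)"
  by (simp_all add: universal_cover_def)

lemma cover_simps [simp]:
  "carrier (cfam D n g) = {g} \<times> carrier (A n)"
  "(a, c) \<otimes>\<^bsub>cfam D n g\<^esub> (b, d) = (g, c \<otimes>\<^bsub>A n\<^esub> d)" "\<one>\<^bsub>cfam D n g\<^esub> = (g, \<one>\<^bsub>A n\<^esub>)"
  "cbase D n (g, c) = g" "cbd D n (g, c) = (g, cbd C n c)"
  "cact D n (g, c) (a, u) = (g \<otimes>\<^bsub>G\<^esub> \<phi> u, cact C n c u)"
  by (simp_all add: universal_cover_def)

lemma cover_groupoid: "groupoid (cgrpd D)"
  by unfold_locales
     (auto simp: G.m_assoc F.m_assoc intro!: bexI[of _ "inv\<^bsub>F\<^esub> _"])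

lemma ginv_D:
  assumes "g \<in> carrier G" "u \<in> carrier F"
  shows "ginv (cgrpd D) (g, u) = (g \<otimes>\<^bsub>G\<^esub> \<phi> u, inv\<^bsub>F\<^esub> u)"
  by (rule groupoid.ginv_equality[OF cover_groupoid]) (use assms in \<open>auto simp: G.m_assoc\<close>)

lemma group_cover: "2 \<le> n \<Longrightarrow> n \<le> m \<Longrightarrow> group (cfam D n g)"
proof -
  assume n: "2 \<le> n" "n \<le> m"
  interpret An: group "A n" by (rule group_A[OF n])
  show ?thesis
    by (rule groupI) (auto simp: An.m_assoc intro!: bexI[of _ "(_, inv\<^bsub>A n\<^esub> _)"])
qed

lemma inv_cover:
  assumes "2 \<le> n" "n \<le> m" "c \<in> carrier (A n)"
  shows "inv\<^bsub>cfam D n g\<^esub> (g, c) = (g, inv\<^bsub>A n\<^esub> c)"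
proof -
  interpret An: group "A n" using group_A assms by simp
  show ?thesis
    by (rule group.inv_equality[OF group_cover]) (use assms in auto)
qed

lemma subgroup_cover:
  assumes "2 \<le> n" "n \<le> m" "subgroup S (A n)"
  shows "subgroup ({g} \<times> S) (cfam D n g)"
proof -
  interpret S: subgroup S "A n" by fact
  show ?thesis
    by (rule subgroup.intro)
       (use inv_cover[OF assms(1,2)] in auto)
qed

end

section \<open>The contraction onto the kernel\<close>

locale contraction = resolution m G pt C \<phi>
  for m and G :: "'g monoid" and pt :: 'o and C :: "('o, 'c) crossed_complex" and \<phi> :: "'c \<Rightarrow> 'g" +
  fixes h0 :: "'g \<Rightarrow> 'g \<times> 'c" and h :: "nat \<Rightarrow> 'g \<times> 'c \<Rightarrow> 'g \<times> 'c"
  assumes homotopy: "partial_contracting_homotopy m D \<one>\<^bsub>G\<^esub> h0 h"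
begin

text \<open>The first coordinates of the homotopy are forced: \<open>h0 g\<close> starts at
  \<open>g\<close>, and every \<open>h n\<close> with \<open>n \<ge> 1\<close> takes values over the
  base point 1. So only second coordinates are named.\<close>

abbreviation w :: "'g \<Rightarrow> 'c" where "w g \<equiv> snd (h0 g)"

abbreviation k :: "nat \<Rightarrow> 'g \<Rightarrow> 'c \<Rightarrow> 'c" where "k n g c \<equiv> snd (h n (g, c))"

lemma h0_props:
  assumes "g \<in> carrier G"
  shows "h0 g = (g, w g)" "w g \<in> carrier F" "g \<otimes>\<^bsub>G\<^esub> \<phi> (w g) = \<one>\<^bsub>G\<^esub>"
proof -
  have "h0 g \<in> garrows (cgrpd D) g \<one>\<^bsub>G\<^esub>"
    using homotopy assms by (simp add: partial_contracting_homotopy_def Let_def)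
  then show "h0 g = (g, w g)" "w g \<in> carrier F" "g \<otimes>\<^bsub>G\<^esub> \<phi> (w g) = \<one>\<^bsub>G\<^esub>"
    by (cases "h0 g"; auto simp: garrows_def)+
qed

lemma phi_w: "g \<in> carrier G \<Longrightarrow> \<phi> (w g) = inv\<^bsub>G\<^esub> g"
  using h0_props by (metis G.inv_comm G.inv_equality \<phi>.hom_closed)

text \<open>The arrow \<open>(g, u)\<close> ends at \<open>g \<otimes> \<phi> u\<close>; this
  explains the shifted base point in the product rule and in the boundary formula.\<close>

lemma h1_props:
  assumes "2 \<le> m" "g \<in> carrier G" "u \<in> carrier F"
  shows "h 1 (g, u) = (\<one>\<^bsub>G\<^esub>, k 1 g u)" "k 1 g u \<in> carrier (A 2)"
    "v \<in> carrier F \<Longrightarrow> k 1 g (u \<otimes>\<^bsub>F\<^esub> v) = k 1 g u \<otimes>\<^bsub>A 2\<^esub> k 1 (g \<otimes>\<^bsub>G\<^esub> \<phi> u) v"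
    "cbd C 2 (k 1 g u) = inv\<^bsub>F\<^esub> w g \<otimes>\<^bsub>F\<^esub> u \<otimes>\<^bsub>F\<^esub> w (g \<otimes>\<^bsub>G\<^esub> \<phi> u)"
proof -
  have *: "h 1 (g, u) \<in> carrier (cfam D 2 \<one>\<^bsub>G\<^esub>)" if "g \<in> carrier G" "u \<in> carrier F" for g u
    using homotopy assms that by (simp add: partial_contracting_homotopy_def Let_def)
  then have h1: "h 1 (g, u) = (\<one>\<^bsub>G\<^esub>, k 1 g u) \<and> k 1 g u \<in> carrier (A 2)"
    if "g \<in> carrier G" "u \<in> carrier F" for g u
    using *[OF that] by (cases "h 1 (g, u)") auto
  show "h 1 (g, u) = (\<one>\<^bsub>G\<^esub>, k 1 g u)" "k 1 g u \<in> carrier (A 2)"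
    using h1 assms by blast+
  have "h 1 (gcmp (cgrpd D) (g, u) (g \<otimes>\<^bsub>G\<^esub> \<phi> u, v)) =
      h 1 (g, u) \<otimes>\<^bsub>cfam D 2 \<one>\<^bsub>G\<^esub>\<^esub> h 1 (g \<otimes>\<^bsub>G\<^esub> \<phi> u, v)" if "v \<in> carrier F"
    using homotopy assms that by (simp add: partial_contracting_homotopy_def Let_def)
  then show "k 1 g (u \<otimes>\<^bsub>F\<^esub> v) = k 1 g u \<otimes>\<^bsub>A 2\<^esub> k 1 (g \<otimes>\<^bsub>G\<^esub> \<phi> u) v" if "v \<in> carrier F"
    using that h1[of g u] h1[of "g \<otimes>\<^bsub>G\<^esub> \<phi> u" v] assms by (metis cover_groupoid_simps(6) cover_simps(2)
      G.m_closed \<phi>.hom_closed snd_conv)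
  have "cbd D 2 (h 1 (g, u)) = gcmp (cgrpd D) (gcmp (cgrpd D) (ginv (cgrpd D) (h0 g)) (g, u))
      (h0 (g \<otimes>\<^bsub>G\<^esub> \<phi> u))"
    using homotopy assms by (simp add: partial_contracting_homotopy_def Let_def)
  then have "cbd D 2 (\<one>\<^bsub>G\<^esub>, k 1 g u) = gcmp (cgrpd D) (gcmp (cgrpd D) (ginv (cgrpd D) (g, w g)) (g, u))
      (g \<otimes>\<^bsub>G\<^esub> \<phi> u, w (g \<otimes>\<^bsub>G\<^esub> \<phi> u))"
    using h1[of g u] h0_props(1)[of g] h0_props(1)[of "g \<otimes>\<^bsub>G\<^esub> \<phi> u"] assms
    by (metis G.m_closed \<phi>.hom_closed)
  then show "cbd C 2 (k 1 g u) = inv\<^bsub>F\<^esub> w g \<otimes>\<^bsub>F\<^esub> u \<otimes>\<^bsub>F\<^esub> w (g \<otimes>\<^bsub>G\<^esub> \<phi> u)"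
    using assms h0_props(2) by (simp add: ginv_D)
qed

text \<open>The condition on \<open>h 1\<close> mentions only composites; applied to 1 = 1 * 1 it
  makes the value at an identity an idempotent of a group.\<close>

lemma h1_one:
  assumes "2 \<le> m" "g \<in> carrier G"
  shows "k 1 g \<one>\<^bsub>F\<^esub> = \<one>\<^bsub>A 2\<^esub>"
proof -
  interpret A2: group "A 2" using group_A assms by simp
  show ?thesis
    using h1_props(3)[of g "\<one>\<^bsub>F\<^esub>" "\<one>\<^bsub>F\<^esub>"] h1_props(2)[of g "\<one>\<^bsub>F\<^esub>"] assms
      A2.r_cancel_one'[of "k 1 g \<one>\<^bsub>F\<^esub>" "k 1 g \<one>\<^bsub>F\<^esub>"] by simp
qed

lemma hn_props:
  assumes "2 \<le> n" "n < m" "g \<in> carrier G"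
  shows "c \<in> carrier (A n) \<Longrightarrow> h n (g, c) = (\<one>\<^bsub>G\<^esub>, k n g c)"
    "k n g \<in> hom (A n) (A (n + 1))"
    "\<lbrakk>u \<in> carrier F; c \<in> carrier (A n)\<rbrakk> \<Longrightarrow> k n (g \<otimes>\<^bsub>G\<^esub> \<phi> u) (cact C n c u) = k n g c"
proof -
  have hom: "h n \<in> hom (cfam D n g) (cfam D (n + 1) \<one>\<^bsub>G\<^esub>)"
    using homotopy assms by (simp add: partial_contracting_homotopy_def Let_def)
  have h: "h n (g, c) = (\<one>\<^bsub>G\<^esub>, k n g c) \<and> k n g c \<in> carrier (A (n + 1))" if "c \<in> carrier (A n)" for c
    using hom_in_carrier[OF hom, of "(g, c)"] that by (cases "h n (g, c)") auto
  then show "c \<in> carrier (A n) \<Longrightarrow> h n (g, c) = (\<one>\<^bsub>G\<^esub>, k n g c)" by blast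
  have "k n g (c \<otimes>\<^bsub>A n\<^esub> d) = k n g c \<otimes>\<^bsub>A (n + 1)\<^esub> k n g d"
    if "c \<in> carrier (A n)" "d \<in> carrier (A n)" for c d
  proof -
    have "h n (g, c \<otimes>\<^bsub>A n\<^esub> d) = h n (g, c) \<otimes>\<^bsub>cfam D (n + 1) \<one>\<^bsub>G\<^esub>\<^esub> h n (g, d)"
      using hom_mult[OF hom, of "(g, c)" "(g, d)"] that by simp
    also have "\<dots> = (\<one>\<^bsub>G\<^esub>, k n g c \<otimes>\<^bsub>A (n + 1)\<^esub> k n g d)"
      using h[OF that(1)] h[OF that(2)] by (metis cover_simps(2))
    finally show ?thesis by simp
  qed
  then show "k n g \<in> hom (A n) (A (n + 1))" using h by (intro homI) auto
  have "\<forall>a \<in> garr (cgrpd D). \<forall>c \<in> carrier (cfam D n (gsrc (cgrpd D) a)). h n (cact D n c a) = h n c"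
    using homotopy assms by (auto simp only: partial_contracting_homotopy_def Let_def atLeastLessThan_iff)
  from this[rule_format, of "(g, u)" "(g, c)"]
  show "k n (g \<otimes>\<^bsub>G\<^esub> \<phi> u) (cact C n c u) = k n g c" if "u \<in> carrier F" "c \<in> carrier (A n)"
    using that assms by simp
qed

text \<open>The map \<open>h (n - 1)\<close> starts from the groupoid when \<open>n = 2\<close> and
  from a family of groups otherwise, hence the case split. In both cases its value lies over 1,
  where the inverse is computed in \<open>A n\<close>.\<close>

lemma boundary_hn:
  assumes n: "2 \<le> n" "n < m" and g: "g \<in> carrier G" and c: "c \<in> carrier (A n)"
  shows "cbd C (n + 1) (k n g c) =
    inv\<^bsub>A n\<^esub> k (n - 1) g (cbd C n c) \<otimes>\<^bsub>A n\<^esub> cact C n c (w g)"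
proof -
  have "cbd D (n + 1) (h n (g, c)) = inv\<^bsub>cfam D n \<one>\<^bsub>G\<^esub>\<^esub> (h (n - 1) (cbd D n (g, c)))
      \<otimes>\<^bsub>cfam D n \<one>\<^bsub>G\<^esub>\<^esub> cact D n (g, c) (h0 (cbase D n (g, c)))"
    using homotopy n g c
    by (simp only: partial_contracting_homotopy_def Let_def atLeastLessThan_iff) auto
  moreover have "h (n - 1) (g, cbd C n c) = (\<one>\<^bsub>G\<^esub>, k (n - 1) g (cbd C n c)) \<and>
      k (n - 1) g (cbd C n c) \<in> carrier (A n)"
  proof (cases "n = 2")
    case True
    then show ?thesis
      using h1_props(1,2)[of g "cbd C 2 c"] hom_in_carrier[OF boundary2_hom, of c] n g c by simp
  next
    case False
    then have bd: "cbd C n c \<in> carrier (A (n - 1))"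
      using hom_in_carrier[OF boundary3_hom, of n c] n c by simp
    then show ?thesis
      using hn_props(1)[of "n - 1" g] hom_in_carrier[OF hn_props(2)[of "n - 1" g] bd] n g False by simp
  qed
  moreover have "h n (g, c) = (\<one>\<^bsub>G\<^esub>, k n g c)" by (rule hn_props(1)[OF n g c])
  moreover have "h0 g = (g, w g)" by (rule h0_props(1)[OF g])
  ultimately have "cbd D (n + 1) (\<one>\<^bsub>G\<^esub>, k n g c) =
      (\<one>\<^bsub>G\<^esub>, inv\<^bsub>A n\<^esub> k (n - 1) g (cbd C n c)) \<otimes>\<^bsub>cfam D n \<one>\<^bsub>G\<^esub>\<^esub> cact D n (g, c) (g, w g)"
    using n by (metis cover_simps(4,5) inv_cover less_imp_le)
  then show ?thesis by simp
qed

section \<open>The map \<theta> in dimensions at least 2\<close>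

abbreviation \<kappa> :: "'g \<Rightarrow> 'c \<Rightarrow> 'c" where "\<kappa> g c \<equiv> k (m - 1) g (cbd C m c)"

text \<open>The right-hand side of the homotopy relation one step beyond the truncation: the second
  coordinate of what the boundary of \<open>h m\<close> would have to be.\<close>

definition \<theta> :: "'g \<Rightarrow> 'c \<Rightarrow> 'c" where
  "\<theta> g c = inv\<^bsub>A m\<^esub> \<kappa> g c \<otimes>\<^bsub>A m\<^esub> cact C m c (w g)"

text \<open>For \<open>m = 2\<close> boundaries lie in the kernel of \<phi>, so the base point does
  not move and the composition rule of \<open>h 1\<close> becomes multiplicativity at
  \<open>g\<close>. For larger \<open>m\<close> this is a composite of homomorphisms.\<close>

lemma kappa_hom:
  assumes m: "2 \<le> m" and g: "g \<in> carrier G"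
  shows "\<kappa> g \<in> hom (A m) (A m)"
proof (cases "m = 2")
  case True
  interpret b: group_hom "A 2" F "cbd C 2"
    using boundary_group_hom[of 2] m by (simp add: dim_group_def)
  have "\<phi> (cbd C 2 c) = \<one>\<^bsub>G\<^esub>" if "c \<in> carrier (A 2)" for c
    using kernel_phi[OF m] that by (auto simp: kernel_def)
  then show ?thesis
    using h1_props(2,3)[OF m g] g by (intro homI) (auto simp: True simp flip: One_nat_def)
next
  case False
  then have "cbd C m \<in> hom (A m) (A (m - 1))" "k (m - 1) g \<in> hom (A (m - 1)) (A m)"
    using boundary3_hom[of m] hn_props(2)[of "m - 1" g] m g by simp_all
  then show ?thesis using hom_compose[of "cbd C m"] by (simp add: comp_def)
qed

text \<open>This is the homotopy relation in dimension \<open>m - 1\<close> applied to the boundary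
  of \<open>c\<close>. For \<open>m = 2\<close> it gives a conjugate of that boundary by
  \<open>w g\<close>; for \<open>m \<ge> 3\<close> the term with two boundaries vanishes.
  Equivariance of the boundary then gives the right-hand side.\<close>

lemma boundary_kappa:
  assumes m: "2 \<le> m" and g: "g \<in> carrier G" and c: "c \<in> carrier (A m)"
  shows "cbd C m (\<kappa> g c) = cbd C m (cact C m c (w g))"
proof (cases "m = 2")
  case True
  have "cbd C 2 c \<in> carrier F" "\<phi> (cbd C 2 c) = \<one>\<^bsub>G\<^esub>"
    using kernel_phi[OF m] c True by (auto simp: kernel_def)
  then show ?thesis
    using h1_props(4)[OF m g, of "cbd C 2 c"] boundary2_act[OF m, of "w g" c] h0_props(2)[OF g] g c
    by (simp add: True)
next
  case False
  then have m3: "3 \<le> m" using m by simp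
  then have m1: "2 \<le> m - 1" "m - 1 < m" "m - 1 + 1 = m" "m - 1 - 1 = m - 2" by auto
  interpret A1: group "A (m - 1)" by (rule group_A) (use m1 in auto)
  have bc: "cbd C m c \<in> carrier (A (m - 1))"
    using hom_in_carrier[OF boundary3_hom[of m] c] m3 by simp
  \<comment> \<open>For \<open>m = 3\<close> the identity in question is that of \<open>F\<close>
    and the map is \<open>h 1\<close>, which is a groupoid morphism and not a family of group
    homomorphisms.\<close>
  have "k (m - 2) g \<one>\<^bsub>dim_group C (m - 2) pt\<^esub> = \<one>\<^bsub>A (m - 1)\<^esub>"
  proof (cases "m = 3")
    case True
    then show ?thesis using h1_one[OF m g] by (simp add: dim_group_def)
  next
    case False
    then have m2: "2 \<le> m - 2" "m - 2 \<le> m" "m - 2 < m" "m - 2 + 1 = m - 1" using m3 by auto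
    then have "group_hom (A (m - 2)) (A (m - 1)) (k (m - 2) g)"
      using hn_props(2)[OF m2(1,3) g]
      by (intro group_hom.intro group_hom_axioms.intro group_A) auto
    then show ?thesis using m2 group_hom.hom_one by (fastforce simp: dim_group_def)
  qed
  then have "k (m - 2) g (cbd C (m - 1) (cbd C m c)) = \<one>\<^bsub>A (m - 1)\<^esub>"
    using boundary_boundary[OF m3 _ c] by simp
  then show ?thesis
    using boundary_hn[OF m1(1,2) g bc] boundary_act[OF m3 _ h0_props(2)[OF g] c]
      act_closed[of "m - 1" "w g" "cbd C m c"] h0_props(2)[OF g] bc m1 by (simp del: One_nat_def)
qed

text \<open>The two factors of \<theta> have mutually inverse boundaries by
  \<open>boundary_kappa\<close>.\<close>

lemma theta_kern:
  assumes m: "2 \<le> m" and g: "g \<in> carrier G" and c: "c \<in> carrier (A m)"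
  shows "\<theta> g c \<in> kern m"
proof -
  interpret b: group_hom "A m" "dim_group C (m - 1) pt" "cbd C m"
    by (rule boundary_group_hom) (use m in auto)
  have "\<kappa> g c \<in> carrier (A m)" by (rule hom_in_carrier[OF kappa_hom[OF m g] c])
  moreover have "cact C m c (w g) \<in> carrier (A m)"
    using act_closed m g c h0_props by simp
  ultimately show ?thesis
    using boundary_kappa[OF m g c] by (simp add: kernel_def \<theta>_def del: One_nat_def)
qed

text \<open>Inversion reverses the order of the factors \<open>\<kappa> g c\<close> and
  \<open>\<kappa> g d\<close>. The order is restored by moving the inverse of
  \<open>\<kappa> g d\<close> past \<open>\<theta> g c\<close>, which is central because it lies in
  the kernel.\<close>

lemma theta_hom:
  assumes m: "2 \<le> m" and g: "g \<in> carrier G"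
  shows "\<theta> g \<in> hom (A m) (A m)"
proof (rule homI)
  interpret A: group "A m" using group_A m by simp
  show "\<theta> g c \<in> carrier (A m)" if "c \<in> carrier (A m)" for c
    using theta_kern[OF m g that] by (simp add: kernel_def)
  fix c d assume c: "c \<in> carrier (A m)" and d: "d \<in> carrier (A m)"
  note kap = hom_in_carrier[OF kappa_hom[OF m g]] hom_mult[OF kappa_hom[OF m g]]
  note wg = h0_props(2)[OF g]
  let ?c = "cact C m c (w g)" and ?d = "cact C m d (w g)"
  have cd: "?c \<in> carrier (A m)" "?d \<in> carrier (A m)" using act_closed m wg c d by simp_all
  have "\<theta> g c \<otimes>\<^bsub>A m\<^esub> \<theta> g d = \<theta> g c \<otimes>\<^bsub>A m\<^esub> inv\<^bsub>A m\<^esub> \<kappa> g d \<otimes>\<^bsub>A m\<^esub> ?d"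
    using kap c d cd by (simp add: \<theta>_def A.m_assoc)
  also have "\<dots> = inv\<^bsub>A m\<^esub> \<kappa> g d \<otimes>\<^bsub>A m\<^esub> \<theta> g c \<otimes>\<^bsub>A m\<^esub> ?d"
    using kern_comm[OF m _ theta_kern[OF m g c], of "inv\<^bsub>A m\<^esub> \<kappa> g d"] kap d by simp
  also have "\<dots> = \<theta> g (c \<otimes>\<^bsub>A m\<^esub> d)"
    using kap c d cd wg m by (simp add: \<theta>_def A.m_assoc A.inv_mult_group act_mult)
  finally show "\<theta> g (c \<otimes>\<^bsub>A m\<^esub> d) = \<theta> g c \<otimes>\<^bsub>A m\<^esub> \<theta> g d" by simp
qed

text \<open>Multiplying the bracketed element by \<open>w g\<close> on the left gives
  \<open>u\<close> times the connecting element at the new base point. By \<open>h1_props\<close>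
  the bracket is the boundary of \<open>k 1 g u\<close>, and it lies in the kernel of
  \<phi>.\<close>

lemma act_w:
  assumes m: "2 \<le> m" and g: "g \<in> carrier G" and u: "u \<in> carrier F" and c: "c \<in> carrier (A m)"
  shows "cact C m (cact C m c u) (w (g \<otimes>\<^bsub>G\<^esub> \<phi> u)) =
    cact C m (cact C m c (w g)) (inv\<^bsub>F\<^esub> w g \<otimes>\<^bsub>F\<^esub> u \<otimes>\<^bsub>F\<^esub> w (g \<otimes>\<^bsub>G\<^esub> \<phi> u))"
proof -
  let ?v = "w (g \<otimes>\<^bsub>G\<^esub> \<phi> u)"
  have w: "w g \<in> carrier F" "?v \<in> carrier F" using h0_props g u by simp_all
  have "w g \<otimes>\<^bsub>F\<^esub> (inv\<^bsub>F\<^esub> w g \<otimes>\<^bsub>F\<^esub> u \<otimes>\<^bsub>F\<^esub> ?v) = u \<otimes>\<^bsub>F\<^esub> ?v"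
    using w u by (simp add: F.m_assoc[symmetric])
  then show ?thesis using w u m c by (simp add: act_cmp[symmetric])
qed

text \<open>For \<open>m = 2\<close>, passing from \<open>(g, c)\<close> to its image under
  \<open>u\<close> conjugates both factors of \<theta> by \<open>k 1 g u\<close>. Hence it
  conjugates the value of \<theta>, which is central. For \<open>m \<ge> 3\<close> each factor is
  unchanged: the first by invariance of the homotopy, the second because the kernel of \<phi> acts
  trivially.\<close>

lemma theta_act:
  assumes m: "2 \<le> m" and g: "g \<in> carrier G" and u: "u \<in> carrier F" and c: "c \<in> carrier (A m)"
  shows "\<theta> (g \<otimes>\<^bsub>G\<^esub> \<phi> u) (cact C m c u) = \<theta> g c"
proof (cases "m = 2")
  case True
  interpret A: group "A 2" using group_A m by simp
  let ?g = "g \<otimes>\<^bsub>G\<^esub> \<phi> u" and ?x = "k 1 g u" and ?d = "cbd C 2 c" and ?c = "cact C 2 c (w g)"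
  have g': "?g \<in> carrier G" "?g \<otimes>\<^bsub>G\<^esub> inv\<^bsub>G\<^esub> \<phi> u = g" using g u by (simp_all add: G.m_assoc)
  have d: "?d \<in> carrier F" "\<phi> ?d = \<one>\<^bsub>G\<^esub>"
    using kernel_phi[OF m] c True by (auto simp: kernel_def)
  have x: "?x \<in> carrier (A 2)" "k 1 ?g (inv\<^bsub>F\<^esub> u) \<in> carrier (A 2)" "k 1 g ?d \<in> carrier (A 2)"
    using h1_props(2) m g g' u d by simp_all
  have c': "?c \<in> carrier (A 2)" using act_closed m c h0_props(2)[OF g] True by simp
  \<comment> \<open>The path \<open>u\<close> from \<open>g\<close> to \<open>?g\<close>, followed
    by its inverse, is the identity at \<open>g\<close>.\<close>
  have "?x \<otimes>\<^bsub>A 2\<^esub> k 1 ?g (inv\<^bsub>F\<^esub> u) = \<one>\<^bsub>A 2\<^esub>"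
    using h1_props(3)[OF m g u, of "inv\<^bsub>F\<^esub> u"] h1_one[OF m g] u by simp
  then have inv_x: "k 1 ?g (inv\<^bsub>F\<^esub> u) = inv\<^bsub>A 2\<^esub> ?x"
    using x by (metis A.inv_equality A.inv_inv A.inv_closed)
  \<comment> \<open>The loop at \<open>?g\<close> is split into the path back to \<open>g\<close>,
    the loop \<open>?d\<close> at \<open>g\<close>, and the path \<open>u\<close> to
    \<open>?g\<close>.\<close>
  have "k 1 ?g (inv\<^bsub>F\<^esub> u \<otimes>\<^bsub>F\<^esub> ?d \<otimes>\<^bsub>F\<^esub> u) = inv\<^bsub>A 2\<^esub> ?x \<otimes>\<^bsub>A 2\<^esub> k 1 g ?d \<otimes>\<^bsub>A 2\<^esub> ?x"
    using h1_props(3)[OF m g'(1), of "inv\<^bsub>F\<^esub> u \<otimes>\<^bsub>F\<^esub> ?d" u] h1_props(3)[OF m g'(1), of "inv\<^bsub>F\<^esub> u" ?d]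
      g g' u d inv_x by simp
  then have kap: "k 1 ?g (cbd C 2 (cact C 2 c u)) = inv\<^bsub>A 2\<^esub> ?x \<otimes>\<^bsub>A 2\<^esub> k 1 g ?d \<otimes>\<^bsub>A 2\<^esub> ?x"
    using boundary2_act[OF m u, of c] c True by simp
  have theta2: "\<theta> g c = inv\<^bsub>A 2\<^esub> k 1 g (cbd C 2 c) \<otimes>\<^bsub>A 2\<^esub> cact C 2 c (w g)" for g c
    unfolding \<theta>_def by (simp add: True)
  have theta: "\<theta> g c \<in> carrier (A 2)" "\<theta> g c \<otimes>\<^bsub>A 2\<^esub> ?x = ?x \<otimes>\<^bsub>A 2\<^esub> \<theta> g c"
    using kern_comm[OF m _ theta_kern[OF m g c], of ?x] theta_kern[OF m g c] x True
    by (simp_all add: kernel_def)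
  \<comment> \<open>By \<open>act_w\<close> the extra action is that of the boundary of
    \<open>?x\<close>, which the Peiffer law turns into conjugation by \<open>?x\<close>.\<close>
  have "cact C 2 (cact C 2 c u) (w ?g) = inv\<^bsub>A 2\<^esub> ?x \<otimes>\<^bsub>A 2\<^esub> ?c \<otimes>\<^bsub>A 2\<^esub> ?x"
    using act_w[OF m g u c] h1_props(4)[OF m g u] peiffer[OF m c' x(1)] True by simp
  then have "\<theta> ?g (cact C 2 c u) =
      inv\<^bsub>A 2\<^esub> (inv\<^bsub>A 2\<^esub> ?x \<otimes>\<^bsub>A 2\<^esub> k 1 g ?d \<otimes>\<^bsub>A 2\<^esub> ?x) \<otimes>\<^bsub>A 2\<^esub> (inv\<^bsub>A 2\<^esub> ?x \<otimes>\<^bsub>A 2\<^esub> ?c \<otimes>\<^bsub>A 2\<^esub> ?x)"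
    by (simp only: theta2 kap)
  also have "\<dots> = inv\<^bsub>A 2\<^esub> ?x \<otimes>\<^bsub>A 2\<^esub> (\<theta> g c \<otimes>\<^bsub>A 2\<^esub> ?x)"
    unfolding theta2 using x c' by (simp add: A.m_assoc A.inv_mult_group)
      (simp add: A.m_assoc[symmetric])
  also have "\<dots> = \<theta> g c"
    using theta x by (simp add: A.m_assoc[symmetric])
  finally show ?thesis using True by simp
next
  case False
  then have m3: "3 \<le> m" and m1: "2 \<le> m - 1" "m - 1 < m" using m by auto
  let ?v = "inv\<^bsub>F\<^esub> w g \<otimes>\<^bsub>F\<^esub> u \<otimes>\<^bsub>F\<^esub> w (g \<otimes>\<^bsub>G\<^esub> \<phi> u)"
  have w: "w g \<in> carrier F" "w (g \<otimes>\<^bsub>G\<^esub> \<phi> u) \<in> carrier F" using h0_props g u by simp_all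
  have "\<phi> ?v = \<one>\<^bsub>G\<^esub>"
    using w g u phi_w[of g] phi_w[of "g \<otimes>\<^bsub>G\<^esub> \<phi> u"] by simp
  then have "?v \<in> kernel F G \<phi>" using w u by (simp add: kernel_def)
  then have "cact C m (cact C m c u) (w (g \<otimes>\<^bsub>G\<^esub> \<phi> u)) = cact C m c (w g)"
    using act_w[OF m g u c] trivial_act[OF m3] act_closed m c w by simp
  moreover have "cbd C m c \<in> carrier (A (m - 1))"
    using hom_in_carrier[OF boundary3_hom[of m] c] m3 by simp
  then have "\<kappa> (g \<otimes>\<^bsub>G\<^esub> \<phi> u) (cact C m c u) = \<kappa> g c"
    using hn_props(3)[OF m1 g u] boundary_act[OF m3 _ u c] by simp
  ultimately show ?thesis by (simp add: \<theta>_def)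
qed

text \<open>The factor with \<kappa> is trivial because \<open>z\<close> has trivial boundary. The
  element \<open>w\<close> at 1 lies over 1, so it fixes \<open>z\<close>.\<close>

lemma theta_one:
  assumes m: "2 \<le> m" and z: "z \<in> kern m"
  shows "\<theta> \<one>\<^bsub>G\<^esub> z = z"
proof -
  interpret A: group "A m" using group_A m by simp
  interpret kap: group_hom "A m" "A m" "\<kappa> \<one>\<^bsub>G\<^esub>"
    by (intro group_hom.intro group_hom_axioms.intro A.is_group kappa_hom m) simp
  interpret b: group_hom "A m" "dim_group C (m - 1) pt" "cbd C m"
    by (rule boundary_group_hom) (use m in auto)
  \<comment> \<open>Written as the boundary of 1, the trivial boundary allows
    \<open>\<kappa>\<close> at \<open>z\<close> to be replaced by \<open>\<kappa>\<close> at 1,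
    which is 1 for a homomorphism.\<close>
  have zA: "z \<in> carrier (A m)" "cbd C m z = cbd C m \<one>\<^bsub>A m\<^esub>" using z by (simp_all add: kernel_def)
  have "\<kappa> \<one>\<^bsub>G\<^esub> z = \<one>\<^bsub>A m\<^esub>" using kap.hom_one zA(2) by simp
  moreover have "w \<one>\<^bsub>G\<^esub> \<in> kernel F G \<phi>"
    using h0_props(2)[of "\<one>\<^bsub>G\<^esub>"] phi_w[of "\<one>\<^bsub>G\<^esub>"] by (simp add: kernel_def)
  ultimately show ?thesis
    using trivial_act_kern[OF m _ z] zA by (simp add: \<theta>_def)
qed

text \<open>Identifies the generators in the form given by the cover and the homotopy with the
  values of \<theta>.\<close>

lemma generator_eq_theta:
  assumes m: "2 \<le> m" and g: "g \<in> carrier G" and c: "c \<in> carrier (A m)"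
  shows "cover_proj m (inv\<^bsub>cfam D m \<one>\<^bsub>G\<^esub>\<^esub> (h (m - 1) (cbd D m (g, c)))
     \<otimes>\<^bsub>cfam D m \<one>\<^bsub>G\<^esub>\<^esub> cact D m (g, c) (h0 (cbase D m (g, c)))) = \<theta> g c"
proof -
  have "h (m - 1) (g, cbd C m c) = (\<one>\<^bsub>G\<^esub>, \<kappa> g c)"
  proof (cases "m = 2")
    case True
    then show ?thesis
      using h1_props(1)[of g "cbd C 2 c"] hom_in_carrier[OF boundary2_hom, of c] m g c by simp
  next
    case False
    then have "cbd C m c \<in> carrier (A (m - 1))"
      using hom_in_carrier[OF boundary3_hom, of m c] m c by simp
    then show ?thesis using hn_props(1)[of "m - 1" g] m g False by simp
  qed
  moreover have "inv\<^bsub>cfam D m \<one>\<^bsub>G\<^esub>\<^esub> (\<one>\<^bsub>G\<^esub>, \<kappa> g c) = (\<one>\<^bsub>G\<^esub>, inv\<^bsub>A m\<^esub> \<kappa> g c)"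
    using inv_cover m hom_in_carrier[OF kappa_hom[OF m g] c] by simp
  moreover have "cact D m (g, c) (h0 g) = (g \<otimes>\<^bsub>G\<^esub> \<phi> (w g), cact C m c (w g))"
    by (subst h0_props(1)[OF g]) simp
  ultimately show ?thesis by (simp add: cover_proj_def \<theta>_def)
qed

section \<open>Generation of the kernel in dimensions at least 2\<close>

text \<open>The preimages \<open>S g\<close> of \<open>H\<close> are subgroups because
  \<open>\<theta> g\<close> is a homomorphism, and the action carries them into one another because
  \<theta> is invariant. Freeness makes them everything, and over 1 the map \<theta> fixes the
  kernel.\<close>

lemma kernel_subgroup_eq:
  assumes m: "2 \<le> m" and free: "cover_free_on m G pt C \<phi> Xs"
    and H: "subgroup H (A m)" "H \<subseteq> kern m"
    and gens: "\<And>g c. \<lbrakk>(g, c) \<in> Xs; g \<in> carrier G; c \<in> carrier (A m)\<rbrakk> \<Longrightarrow> \<theta> g c \<in> H"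
  shows "H = kern m"
proof -
  define S where "S g = {c \<in> carrier (A m). \<theta> g c \<in> H}" for g
  interpret A: group "A m" using group_A m by simp
  have "subgroup (S g) (A m)" if "g \<in> carrier G" for g
  proof -
    interpret \<theta>: group_hom "A m" "A m" "\<theta> g"
      by (intro group_hom.intro group_hom_axioms.intro A.is_group theta_hom m that)
    interpret H: subgroup H "A m" by fact
    show ?thesis by (rule A.subgroupI) (auto simp: S_def intro: exI[of _ "\<one>\<^bsub>A m\<^esub>"])
  qed
  then have sub: "subgroup ({g} \<times> S g) (cfam D m g)" if "g \<in> carrier G" for g
    using subgroup_cover m that by simp
  have act: "(g \<otimes>\<^bsub>G\<^esub> \<phi> u, cact C m c u) \<in> {g \<otimes>\<^bsub>G\<^esub> \<phi> u} \<times> S (g \<otimes>\<^bsub>G\<^esub> \<phi> u)"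
    if "g \<in> carrier G" "u \<in> carrier F" "c \<in> S g" for g u c
    using that theta_act[OF m] act_closed m by (simp add: S_def)
  have "{\<one>\<^bsub>G\<^esub>} \<times> S \<one>\<^bsub>G\<^esub> = carrier (cfam D m \<one>\<^bsub>G\<^esub>)"
  proof (cases "m = 2")
    case True
    then have "free_crossed_module_on (cgrpd D) (cfam D m) (cact D m) (cbd D m)
          (\<lambda>g. Xs \<inter> carrier (cfam D m g)) (cbd D m) id"
      using free by (simp add: cover_free_on_def Let_def)
    then show ?thesis
    proof (rule free_crossed_module_on_submodule[where T = "\<lambda>g. {g} \<times> S g"])
      fix a t assume "a \<in> garr (cgrpd D)" "t \<in> {gsrc (cgrpd D) a} \<times> S (gsrc (cgrpd D) a)"
      then show "cact D m t a \<in> {gtgt (cgrpd D) a} \<times> S (gtgt (cgrpd D) a)"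
        using act by (cases a; cases t) auto
    qed (use sub gens in \<open>auto simp: S_def\<close>)
  next
    case False
    then have "free_groupoid_module_on (cover_groupoid G) (cfam D m) (cover_act G C \<phi> m) Xs"
      using free m by (simp add: cover_free_on_def Let_def)
    then show ?thesis
    proof (rule free_groupoid_module_on_submodule[where T = "\<lambda>g. {g} \<times> S g"])
      fix a t assume at: "a \<in> garr (cover_groupoid G)"
        "t \<in> {gsrc (cover_groupoid G) a} \<times> S (gsrc (cover_groupoid G) a)"
      obtain g b c where *: "a = (g, b)" "t = (g, c)" "g \<in> carrier G" "b \<in> carrier G" "c \<in> S g"
        using at by (cases a; cases t) (auto simp: cover_groupoid_def)
      \<comment> \<open>The arrow \<open>(g, b)\<close> acts as \<open>(g, u)\<close> does for the
        chosen preimage \<open>u\<close> of \<open>b\<close>, so stability under the lifted action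
        of \<open>F\<close> suffices.\<close>
      then show "cover_act G C \<phi> m t a \<in>
          {gtgt (cover_groupoid G) a} \<times> S (gtgt (cover_groupoid G) a)"
        using act[of g "inv_into (carrier F) \<phi> b" c] lift_phi[of b]
        by (simp add: cover_act_def induced_act_def cover_groupoid_def)
    qed (use sub gens in \<open>auto simp: S_def cover_groupoid_def\<close>)
  qed
  \<comment> \<open>Cancelling the factor that holds the base point uses that \<open>A m\<close> is
    nonempty.\<close>
  then have S: "S \<one>\<^bsub>G\<^esub> = carrier (A m)" using A.one_closed by (auto simp: times_eq_iff)
  have "z \<in> H" if z: "z \<in> kern m" for z
  proof -
    have "z \<in> S \<one>\<^bsub>G\<^esub>" using z by (simp add: S kernel_def)
    then show ?thesis using theta_one[OF m z] by (simp add: S_def)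
  qed
  then show ?thesis using H(2) by blast
qed

text \<open>A subgroup of the kernel is a subgroup of \<open>A m\<close>, so
  \<open>kernel_subgroup_eq\<close> applies once the generators are rewritten as values of
  \<theta>.\<close>

lemma kernel_generated_as_module:
  assumes m: "2 \<le> m" and free: "cover_free_on m G pt C \<phi> Xs"
  shows "generated_as_module G ((A m)\<lparr>carrier := kern m\<rparr>) (induced_act C \<phi> m)
    ((\<lambda>x. cover_proj m (inv\<^bsub>cfam D m \<one>\<^bsub>G\<^esub>\<^esub> (h (m - 1) (cbd D m x))
       \<otimes>\<^bsub>cfam D m \<one>\<^bsub>G\<^esub>\<^esub> cact D m x (h0 (cbase D m x)))) ` Xs)"
    (is "generated_as_module G ?K _ (?gen ` Xs)")
proof -
  have Xs: "\<exists>g c. x = (g, c) \<and> g \<in> carrier G \<and> c \<in> carrier (A m)" if "x \<in> Xs" for x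
  proof (cases "m = 2")
    case True
    then show ?thesis using free that by (fastforce simp: cover_free_on_def Let_def)
  next
    case False
    then have "Xs \<subseteq> elems (cover_groupoid G) (cfam D m)"
      using free m by (simp add: cover_free_on_def Let_def free_groupoid_module_on_def)
    then show ?thesis using that by (fastforce simp: cover_groupoid_def)
  qed
  have gen: "?gen (g, c) = \<theta> g c" if "g \<in> carrier G" "c \<in> carrier (A m)" for g c
    by (rule generator_eq_theta[OF m that])
  have "?gen ` Xs \<subseteq> kern m"
  proof (rule image_subsetI)
    fix x assume "x \<in> Xs"
    then obtain g c where x: "x = (g, c)" and gc: "g \<in> carrier G" "c \<in> carrier (A m)"
      using Xs by blast
    show "?gen x \<in> kern m" unfolding x gen[OF gc] by (rule theta_kern[OF m gc])
  qed
  moreover have "H = kern m" if H: "subgroup H ?K" "?gen ` Xs \<subseteq> H" for H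
  proof (rule kernel_subgroup_eq[OF m free])
    show "subgroup H (A m)"
      by (rule group.incl_subgroup[OF group_A[OF m order_refl] _ H(1)])
         (rule group_hom.subgroup_kernel[OF boundary_group_hom[OF m order_refl]])
    show "H \<subseteq> kern m" using subgroup.subset[OF H(1)] by simp
    show "\<theta> g c \<in> H" if "(g, c) \<in> Xs" "g \<in> carrier G" "c \<in> carrier (A m)" for g c
      using subsetD[OF H(2) imageI[OF that(1)]] unfolding gen[OF that(2,3)] .
  qed
  ultimately show ?thesis
    using kern_module[OF m order_refl] unfolding generated_as_module_def by simp
qed

section \<open>Generation of the kernel in dimension 1\<close>

text \<open>For a normal subgroup \<open>N\<close> containing the generators, the arrows that \<psi>
  maps into \<open>N\<close> form a subgroupoid containing \<open>Xs\<close>, hence all arrows. A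
  kernel element \<open>u\<close> is conjugate to the value of \<psi> on the loop \<open>u\<close>
  at 1.\<close>

lemma kernel_generated_as_normal_subgroup:
  assumes free: "free_groupoid_on (cgrpd D) Xs"
  shows "generated_as_normal_subgroup F (kernel F G \<phi>)
    ((\<lambda>x. cover_proj 1 (gcmp (cgrpd D)
       (gcmp (cgrpd D) (ginv (cgrpd D) (h0 (gsrc (cgrpd D) x))) x) (h0 (gtgt (cgrpd D) x)))) ` Xs)"
    (is "generated_as_normal_subgroup _ _ (?gen ` Xs)")
proof -
  define \<psi> where "\<psi> g u = inv\<^bsub>F\<^esub> w g \<otimes>\<^bsub>F\<^esub> u \<otimes>\<^bsub>F\<^esub> w (g \<otimes>\<^bsub>G\<^esub> \<phi> u)" for g u
  have w: "w g \<in> carrier F" if "g \<in> carrier G" for g using h0_props(2) that by simp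
  have gen: "?gen (g, u) = \<psi> g u" if "g \<in> carrier G" "u \<in> carrier F" for g u
  proof -
    have "h0 g = (g, w g)" "h0 (g \<otimes>\<^bsub>G\<^esub> \<phi> u) = (g \<otimes>\<^bsub>G\<^esub> \<phi> u, w (g \<otimes>\<^bsub>G\<^esub> \<phi> u))"
      using h0_props(1) that by simp_all
    then have "?gen (g, u) = cover_proj 1 (gcmp (cgrpd D)
        (gcmp (cgrpd D) (ginv (cgrpd D) (g, w g)) (g, u)) (g \<otimes>\<^bsub>G\<^esub> \<phi> u, w (g \<otimes>\<^bsub>G\<^esub> \<phi> u)))"
      by (metis cover_groupoid_simps(3,4) fst_conv)
    then show ?thesis using that w by (simp add: ginv_D cover_proj_def \<psi>_def)
  qed
  have psi_kernel: "\<psi> g u \<in> kernel F G \<phi>" if "g \<in> carrier G" "u \<in> carrier F" for g u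
    using that w phi_w[of g] phi_w[of "g \<otimes>\<^bsub>G\<^esub> \<phi> u"] by (simp add: \<psi>_def kernel_def)
  have Xs: "Xs \<subseteq> carrier G \<times> carrier F" using free by (simp add: free_groupoid_on_def)
  have "kernel F G \<phi> \<subseteq> N" if N: "N \<lhd> F" "?gen ` Xs \<subseteq> N" for N
  proof -
    interpret N: normal N F by fact
    define T where "T = {(g, u). g \<in> carrier G \<and> u \<in> carrier F \<and> \<psi> g u \<in> N}"
    have "T = garr (cgrpd D)"
    proof (rule free_groupoid_on_subgroupoid[OF free])
      show "T \<subseteq> garr (cgrpd D)" by (auto simp: T_def)
      show "Xs \<subseteq> T"
      proof
        fix x assume x: "x \<in> Xs"
        then obtain g u where gu: "x = (g, u)" "g \<in> carrier G" "u \<in> carrier F" using Xs by blast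
        have "\<psi> g u \<in> N" using subsetD[OF N(2) imageI[OF x]] unfolding gu(1) gen[OF gu(2,3)] .
        then show "x \<in> T" using gu by (simp add: T_def)
      qed
      show "gid (cgrpd D) g \<in> T" if "g \<in> gobj (cgrpd D)" for g
        using that w by (simp add: T_def \<psi>_def)
      show "gcmp (cgrpd D) a b \<in> T" if ab: "a \<in> T" "b \<in> T" "gtgt (cgrpd D) a = gsrc (cgrpd D) b" for a b
      proof -
        obtain g u v where guv: "a = (g, u)" "b = (g \<otimes>\<^bsub>G\<^esub> \<phi> u, v)" "g \<in> carrier G" "u \<in> carrier F"
            "v \<in> carrier F" "\<psi> g u \<in> N" "\<psi> (g \<otimes>\<^bsub>G\<^esub> \<phi> u) v \<in> N"
          using ab by (auto simp: T_def)
        have "x \<otimes>\<^bsub>F\<^esub> (inv\<^bsub>F\<^esub> x \<otimes>\<^bsub>F\<^esub> y) = y" if "x \<in> carrier F" "y \<in> carrier F" for x y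
          using that by (simp add: F.m_assoc[symmetric])
        \<comment> \<open>The connecting element at the intermediate base point cancels against its
          inverse.\<close>
        then have "\<psi> g (u \<otimes>\<^bsub>F\<^esub> v) = \<psi> g u \<otimes>\<^bsub>F\<^esub> \<psi> (g \<otimes>\<^bsub>G\<^esub> \<phi> u) v"
          using guv(3-5) w by (simp add: \<psi>_def F.m_assoc G.m_assoc)
        then show ?thesis using guv by (simp add: T_def N.m_closed)
      qed
      show "ginv (cgrpd D) a \<in> T" if a: "a \<in> T" for a
      proof -
        obtain g u where gu: "a = (g, u)" "g \<in> carrier G" "u \<in> carrier F" "\<psi> g u \<in> N"
          using a by (auto simp: T_def)
        have "\<psi> (g \<otimes>\<^bsub>G\<^esub> \<phi> u) (inv\<^bsub>F\<^esub> u) = inv\<^bsub>F\<^esub> \<psi> g u"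
          using gu w by (simp add: \<psi>_def F.m_assoc G.m_assoc F.inv_mult_group)
        then show ?thesis using gu by (simp add: T_def ginv_D N.m_inv_closed)
      qed
    qed
    then have psi: "\<psi> \<one>\<^bsub>G\<^esub> u \<in> N" if "u \<in> carrier F" for u
      using that by (auto simp: T_def set_eq_iff)
    show ?thesis
    proof
      fix u assume u: "u \<in> kernel F G \<phi>"
      let ?w = "w \<one>\<^bsub>G\<^esub>"
      have u': "u \<in> carrier F" "\<phi> u = \<one>\<^bsub>G\<^esub>" "?w \<in> carrier F" using u w by (simp_all add: kernel_def)
      \<comment> \<open>Normality of \<open>N\<close> allows the conjugation by \<open>?w\<close> to
        be undone; since \<open>u\<close> is a loop at 1, the same \<open>?w\<close> stands at both
        ends.\<close>
      have "?w \<otimes>\<^bsub>F\<^esub> (inv\<^bsub>F\<^esub> ?w \<otimes>\<^bsub>F\<^esub> u \<otimes>\<^bsub>F\<^esub> ?w) \<otimes>\<^bsub>F\<^esub> inv\<^bsub>F\<^esub> ?w \<in> N"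
        using N.inv_op_closed2[OF u'(3) psi[OF u'(1)]] u' by (simp add: \<psi>_def)
      moreover have "?w \<otimes>\<^bsub>F\<^esub> (inv\<^bsub>F\<^esub> ?w \<otimes>\<^bsub>F\<^esub> u \<otimes>\<^bsub>F\<^esub> ?w) \<otimes>\<^bsub>F\<^esub> inv\<^bsub>F\<^esub> ?w = u"
        using u' by (simp add: F.m_assoc) (simp add: F.m_assoc[symmetric])
      ultimately show "u \<in> N" by simp
    qed
  qed
  moreover have "?gen ` Xs \<subseteq> kernel F G \<phi>"
  proof (rule image_subsetI)
    fix x assume "x \<in> Xs"
    then obtain g u where x: "x = (g, u)" and gu: "g \<in> carrier G" "u \<in> carrier F" using Xs by blast
    show "?gen x \<in> kernel F G \<phi>" unfolding x gen[OF gu] by (rule psi_kernel[OF gu])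
  qed
  \<comment> \<open>The kernel is thus itself one of the normal subgroups being intersected, which
    gives the other inclusion.\<close>
  moreover have "kernel F G \<phi> \<lhd> F" by (rule \<phi>.normal_kernel)
  ultimately show ?thesis unfolding generated_as_normal_subgroup_def by blast
qed

end

theorem corollary9p3:
  fixes G :: "'g monoid" and C :: "('o, 'c) crossed_complex" and pt :: 'o
    and \<phi> :: "'c \<Rightarrow> 'g" and h0 :: "'g \<Rightarrow> 'g \<times> 'c" and h :: "nat \<Rightarrow> 'g \<times> 'c \<Rightarrow> 'g \<times> 'c"
    and Xs :: "('g \<times> 'c) set" and m :: nat
  defines "D \<equiv> universal_cover G pt C \<phi>"
  assumes "m \<ge> 1"
    and "free_crossed_resolution m G pt C \<phi>"
    and "partial_contracting_homotopy m D \<one>\<^bsub>G\<^esub> h0 h"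
    and "cover_free_on m G pt C \<phi> Xs"
  shows "(m = 1 \<longrightarrow>
      generated_as_normal_subgroup (vertex_group (cgrpd C) pt)
        (kernel (vertex_group (cgrpd C) pt) G \<phi>)
        ((\<lambda>x. cover_proj 1 (gcmp (cgrpd D)
           (gcmp (cgrpd D) (ginv (cgrpd D) (h0 (gsrc (cgrpd D) x))) x)
           (h0 (gtgt (cgrpd D) x)))) ` Xs)) \<and>
    (m \<ge> 2 \<longrightarrow>
      generated_as_module G
        ((cfam C m pt)\<lparr>carrier := kernel (cfam C m pt) (dim_group C (m-1) pt) (cbd C m)\<rparr>)
        (induced_act C \<phi> m)
        ((\<lambda>x. cover_proj m
           (inv\<^bsub>cfam D m \<one>\<^bsub>G\<^esub>\<^esub> (h (m-1) (cbd D m x))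
              \<otimes>\<^bsub>cfam D m \<one>\<^bsub>G\<^esub>\<^esub> cact D m x (h0 (cbase D m x)))) ` Xs))"
proof -
  interpret contraction m G pt C \<phi> h0 h
    by unfold_locales (use assms(3,4) in \<open>simp_all add: D_def\<close>)
  have "free_groupoid_on (cgrpd D) Xs" if "m = 1"
    using assms(5) that by (simp add: cover_free_on_def Let_def D_def)
  then show ?thesis
    using kernel_generated_as_normal_subgroup kernel_generated_as_module assms(5)
    unfolding D_def by blast
qed

end
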